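(* For every set $X$, $\mathrm{Aut}(\mathcal{PI}^{\ast}_X)\cong\mathcal{S}_X$. Moreover, for every automorphism $\varphi$ of $\mathcal{PI}^{\ast}_X$ there is $\pi\in\mathcal{S}_X$ such that $\varphi(a)=\pi^{-1}\star a\star\pi$ for all $a\in\mathcal{PI}^{\ast}_X$.
   Context: Let $X'=\{x':x\in X\}$ be a disjoint copy of $X$. $\mathcal{PI}^{\ast}_X$ is the set of partitions of $X\cup X'$ each of whose blocks is a singleton (point) or a generalised line (a set meeting both $X$ and $X'$), with product $\star$: with $X''$ a third copy of $X$, regard $\alpha$ as a partition of $X\cup X''$ and $\beta$ as a partition of $X''\cup X'$, let $\sim$ be the equivalence on $X\cup X''\cup X'$ generated by the blocks of both; $\alpha\star\beta$ is the partition of $X\cup X'$ in which distinct $u,v$ are in one block iff $u\sim v$ and the $\sim$-class of $u$ contains no singleton block of $\alpha$ or $\beta$. $\mathcal{S}_X$ is its group of units: elements all of whose blocks are $\{x,\pi(x)'\}$ for a permutation $\pi$ of $X$ (identified with the symmetric group on $X$). $\mathrm{Aut}$ denotes the automorphism group. *)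

theory Defs
  imports Main "HOL-Library.Disjoint_Sets" "HOL-Algebra.Bij"
begin

text \<open>Points of X \<union> X': Up x stands for x, Dn x for x'.\<close>
datatype 'a pt = Up 'a | Dn 'a

text \<open>Points of X \<union> X'' \<union> X' used to compute products: T1 x = x, T2 x = x'', T3 x = x'.\<close>
datatype 'a pt3 = T1 'a | T2 'a | T3 'a

definition ground :: "'a set \<Rightarrow> 'a pt set" where
  "ground X = Up ` X \<union> Dn ` X"

definition PIstar :: "'a set \<Rightarrow> 'a pt set set set" where
  "PIstar X = {P. partition_on (ground X) P \<and>
     (\<forall>B\<in>P. (\<exists>u. B = {u}) \<or> ((\<exists>x. Up x \<in> B) \<and> (\<exists>x. Dn x \<in> B)))}"

text \<open>alpha viewed as a partition of X \<union> X'', beta of X'' \<union> X'.\<close>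
fun emb_left :: "'a pt \<Rightarrow> 'a pt3" where
  "emb_left (Up x) = T1 x" | "emb_left (Dn x) = T2 x"
fun emb_right :: "'a pt \<Rightarrow> 'a pt3" where
  "emb_right (Up x) = T2 x" | "emb_right (Dn x) = T3 x"
fun emb_out :: "'a pt \<Rightarrow> 'a pt3" where
  "emb_out (Up x) = T1 x" | "emb_out (Dn x) = T3 x"

definition gen_equiv :: "'a pt set set \<Rightarrow> 'a pt set set \<Rightarrow> ('a pt3 \<times> 'a pt3) set" where
  "gen_equiv \<alpha> \<beta> =
     ((\<Union>B\<in>\<alpha>. emb_left ` B \<times> emb_left ` B) \<union> (\<Union>B\<in>\<beta>. emb_right ` B \<times> emb_right ` B))\<^sup>*"

definition singleton_pts :: "'a pt set set \<Rightarrow> 'a pt set set \<Rightarrow> 'a pt3 set" where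
  "singleton_pts \<alpha> \<beta> = {emb_left u | u. {u} \<in> \<alpha>} \<union> {emb_right u | u. {u} \<in> \<beta>}"

definition PIprod :: "'a set \<Rightarrow> 'a pt set set \<Rightarrow> 'a pt set set \<Rightarrow> 'a pt set set" where
  "PIprod X \<alpha> \<beta> = ground X // {(u, v). u \<in> ground X \<and> v \<in> ground X \<and>
      (u = v \<or> ((emb_out u, emb_out v) \<in> gen_equiv \<alpha> \<beta> \<and>
               (\<forall>s\<in>singleton_pts \<alpha> \<beta>. (emb_out u, s) \<notin> gen_equiv \<alpha> \<beta>)))}"

definition PIid :: "'a set \<Rightarrow> 'a pt set set" where
  "PIid X = {{Up x, Dn x} | x. x \<in> X}"

definition PI_monoid :: "'a set \<Rightarrow> 'a pt set set monoid" where
  "PI_monoid X = \<lparr>carrier = PIstar X, mult = PIprod X, one = PIid X\<rparr>"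

definition perm_elt :: "'a set \<Rightarrow> ('a \<Rightarrow> 'a) \<Rightarrow> 'a pt set set" where
  "perm_elt X p = {{Up x, Dn (p x)} | x. x \<in> X}"

definition SX :: "'a set \<Rightarrow> 'a pt set set set" where
  "SX X = {perm_elt X p | p. bij_betw p X X}"

definition SX_group :: "'a set \<Rightarrow> 'a pt set set monoid" where
  "SX_group X = (PI_monoid X)\<lparr>carrier := SX X\<rparr>"

end

theory Submission
  imports Defs
begin

text \<open>
  Associate with a in PI* the relation lrel a of all pairs (A, B) of subsets of X such that A \<noteq> {} and
  A \<union> B' is a union of generalised lines of a. The map lrel is injective and turns the product
  \<open>\<star>\<close> into relational composition, so all computations take place in relations on subsets of X.

  An element has rank one if it has a single line A \<union> B'; these are the nonzero s with
  s t s \<in> {0, s} for all t, so an automorphism permutes them, and it sends the one with line A \<union> B'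
  to the one with line \<open>\<theta> A \<union> (\<theta> B)'\<close> for a bijection \<open>\<theta>\<close> of the nonempty subsets of X. Hence
  \<open>\<theta>\<close> transports lrel a to lrel of the image of a. For disjoint A, B the element with
  the two lines A \<union> B', B \<union> A' has lrel = {(A, B), (B, A), (A \<union> B, A \<union> B)}. As lrel is
  closed under unions and nonempty intersections, \<open>\<theta>\<close> preserves disjointness and disjoint unions,
  so it is induced by a permutation q of X, and the automorphism is conjugation by q.
\<close>

section \<open>The relation of line unions\<close>

definition pts :: "'a set \<Rightarrow> 'a set \<Rightarrow> 'a pt set" where
  "pts A B = Up ` A \<union> Dn ` B"

text \<open>For \<open>P\<close> in \<open>PIstar X\<close> and \<open>U\<close> inside
  \<open>ground X\<close> this means that \<open>U\<close> is a union of generalised lines of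
  \<open>P\<close>. Testing one point at a time makes closure under unions and intersections
  immediate.\<close>

definition saturated :: "'a pt set set \<Rightarrow> 'a pt set \<Rightarrow> bool" where
  "saturated P U \<longleftrightarrow> (\<forall>L\<in>P. \<forall>u\<in>L. u \<in> U \<longrightarrow> L \<subseteq> U \<and> (\<forall>v. L \<noteq> {v}))"

text \<open>Since a line meets both copies of \<open>X\<close>, for \<open>P\<close> in
  \<open>PIstar X\<close> the condition on \<open>A\<close> discards only the pair of empty sets; an
  element without lines then gets the empty relation.\<close>

definition lrel :: "'a set \<Rightarrow> 'a pt set set \<Rightarrow> ('a set \<times> 'a set) set" where
  "lrel X P = {(A, B). A \<noteq> {} \<and> A \<subseteq> X \<and> B \<subseteq> X \<and> saturated P (pts A B)}"

lemma Up_in_pts [simp]: "Up x \<in> pts A B \<longleftrightarrow> x \<in> A"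
  and Dn_in_pts [simp]: "Dn x \<in> pts A B \<longleftrightarrow> x \<in> B"
  by (auto simp: pts_def)

lemma Up_in_ground [simp]: "Up x \<in> ground X \<longleftrightarrow> x \<in> X"
  and Dn_in_ground [simp]: "Dn x \<in> ground X \<longleftrightarrow> x \<in> X"
  by (auto simp: ground_def)

lemma set_pt_eqI:
  assumes "\<And>x. Up x \<in> U \<longleftrightarrow> Up x \<in> V" "\<And>x. Dn x \<in> U \<longleftrightarrow> Dn x \<in> V"
  shows "U = V"
proof -
  have "u \<in> U \<longleftrightarrow> u \<in> V" for u using assms by (cases u) auto
  then show ?thesis by blast
qed

lemma pts_eq_iff [simp]: "pts A B = pts C D \<longleftrightarrow> A = C \<and> B = D"
  unfolding pts_def by blast

lemma pts_subset_ground: "pts A B \<subseteq> ground X \<longleftrightarrow> A \<subseteq> X \<and> B \<subseteq> X"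
  by (auto simp: pts_def ground_def)

lemma pts_exhaust: obtains A B where "U = pts A B"
proof
  show "U = pts {x. Up x \<in> U} {x. Dn x \<in> U}" by (rule set_pt_eqI) auto
qed

lemma pts_Un: "pts A B \<union> pts C D = pts (A \<union> C) (B \<union> D)"
  by (auto simp: pts_def)

lemma pts_Int: "pts A B \<inter> pts C D = pts (A \<inter> C) (B \<inter> D)"
  by (auto simp: pts_def)

lemma saturatedI:
  "(\<And>L u. L \<in> P \<Longrightarrow> u \<in> L \<Longrightarrow> u \<in> U \<Longrightarrow> L \<subseteq> U \<and> (\<forall>v. L \<noteq> {v})) \<Longrightarrow> saturated P U"
  by (simp add: saturated_def)

lemma saturatedD:
  assumes "saturated P U" "L \<in> P" "u \<in> L" "u \<in> U"
  shows "L \<subseteq> U" "L \<noteq> {v}"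
  using assms by (auto simp: saturated_def)

lemma saturated_Un: "saturated P U \<Longrightarrow> saturated P V \<Longrightarrow> saturated P (U \<union> V)"
  by (rule saturatedI) (metis Un_iff le_supI1 le_supI2 saturatedD)

lemma saturated_Int: "saturated P U \<Longrightarrow> saturated P V \<Longrightarrow> saturated P (U \<inter> V)"
  by (rule saturatedI) (metis Int_iff Int_subset_iff saturatedD)

lemma lrel_Un:
  "(A, B) \<in> lrel X P \<Longrightarrow> (C, D) \<in> lrel X P \<Longrightarrow> (A \<union> C, B \<union> D) \<in> lrel X P"
  using saturated_Un[of P "pts A B" "pts C D"] by (auto simp: lrel_def pts_Un)

lemma lrel_Int:
  "(A, B) \<in> lrel X P \<Longrightarrow> (C, D) \<in> lrel X P \<Longrightarrow> A \<inter> C \<noteq> {} \<Longrightarrow> (A \<inter> C, B \<inter> D) \<in> lrel X P"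
  using saturated_Int[of P "pts A B" "pts C D"] by (auto simp: lrel_def pts_Int)

section \<open>Blocks of an element, and recovering the element from its relation\<close>

lemma PIstar_block:
  assumes "P \<in> PIstar X" "u \<in> ground X"
  shows "\<exists>L\<in>P. u \<in> L \<and> L \<subseteq> ground X"
proof -
  have "\<Union>P = ground X" using assms(1) by (simp add: PIstar_def partition_on_def)
  then show ?thesis using assms(2) by blast
qed

lemma PIstar_block_unique:
  assumes "P \<in> PIstar X" "L \<in> P" "M \<in> P" "u \<in> L" "u \<in> M"
  shows "L = M"
proof (rule ccontr)
  have "disjoint P" using assms(1) by (simp add: PIstar_def partition_on_def)
  moreover assume "L \<noteq> M"
  ultimately have "disjnt L M" using assms(2,3) by (simp add: pairwise_def)
  with assms(4,5) show False by (auto simp: disjnt_def)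
qed

lemma PIstar_block_subset: "P \<in> PIstar X \<Longrightarrow> L \<in> P \<Longrightarrow> L \<subseteq> ground X"
  by (auto simp: PIstar_def partition_on_def)

lemma PIstar_block_nonempty: "P \<in> PIstar X \<Longrightarrow> L \<in> P \<Longrightarrow> L \<noteq> {}"
  by (auto simp: PIstar_def partition_on_def)

lemma PIstar_line:
  assumes "P \<in> PIstar X" "L \<in> P" "\<And>u. L \<noteq> {u}"
  shows "\<exists>x. Up x \<in> L" "\<exists>x. Dn x \<in> L"
proof -
  have "(\<exists>u. L = {u}) \<or> ((\<exists>x. Up x \<in> L) \<and> (\<exists>x. Dn x \<in> L))"
    using assms(1,2) by (simp add: PIstar_def)
  then show "\<exists>x. Up x \<in> L" "\<exists>x. Dn x \<in> L" using assms(3) by blast+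
qed

lemma lrel_block:
  assumes P: "P \<in> PIstar X" and L: "pts A B \<in> P" "\<And>u. pts A B \<noteq> {u}"
  shows "(A, B) \<in> lrel X P"
proof -
  have "A \<noteq> {}" using PIstar_line[OF P L] by auto
  moreover have "saturated P (pts A B)"
    by (rule saturatedI) (metis L P PIstar_block_unique order_refl)
  ultimately show ?thesis
    using PIstar_block_subset[OF P L(1)] by (auto simp: lrel_def pts_subset_ground)
qed

text \<open>The line through a point of \<open>A\<close> stays inside \<open>pts A B\<close> and has
  a primed point.\<close>

lemma lrel_rng_nonempty:
  assumes P: "P \<in> PIstar X" and AB: "(A, B) \<in> lrel X P"
  shows "B \<noteq> {}"
proof -
  obtain x where x: "x \<in> A" "x \<in> X" using AB by (auto simp: lrel_def)
  obtain L where L: "L \<in> P" "Up x \<in> L" using PIstar_block[OF P, of "Up x"] x by auto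
  moreover have "saturated P (pts A B)" using AB by (simp add: lrel_def)
  ultimately have *: "L \<subseteq> pts A B" "\<And>u. L \<noteq> {u}"
    using x by (metis Up_in_pts saturatedD)+
  then obtain y where "Dn y \<in> L" using PIstar_line[OF P L(1)] by blast
  with * show ?thesis by auto
qed

text \<open>Lines are the minimal nonempty saturated sets. A line \<open>L\<close> of
  \<open>P\<close> is saturated for \<open>Q\<close>, so it contains a line \<open>M\<close> of
  \<open>Q\<close>; in turn \<open>M\<close> is saturated for \<open>P\<close> and meets
  \<open>L\<close>, hence contains \<open>L\<close>.\<close>

lemma lrel_line_subset:
  assumes P: "P \<in> PIstar X" and Q: "Q \<in> PIstar X" and eq: "lrel X P = lrel X Q"
    and L: "L \<in> P" "\<And>u. L \<noteq> {u}"
  shows "L \<in> Q"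
proof -
  obtain A B where AB: "L = pts A B" by (rule pts_exhaust)
  have "(A, B) \<in> lrel X P" using lrel_block P L unfolding AB by blast
  then have "(A, B) \<in> lrel X Q" by (simp add: eq)
  then have sQ: "saturated Q L" by (simp add: lrel_def AB)
  obtain u where u: "u \<in> L" using PIstar_block_nonempty[OF P L(1)] by auto
  then obtain M where M: "M \<in> Q" "u \<in> M"
    using PIstar_block[OF Q, of u] PIstar_block_subset[OF P L(1)] by auto
  then have sub: "M \<subseteq> L" "\<And>u. M \<noteq> {u}" using saturatedD[OF sQ] u by auto
  obtain C D where CD: "M = pts C D" by (rule pts_exhaust)
  have "(C, D) \<in> lrel X Q" using lrel_block Q M sub unfolding CD by blast
  then have "(C, D) \<in> lrel X P" by (simp add: eq)
  then have "saturated P M" by (simp add: lrel_def CD)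
  then have "L \<subseteq> M" using saturatedD(1) L M u by metis
  with sub M show ?thesis by auto
qed

text \<open>Singleton blocks are what the lines leave uncovered, so the lines determine the
  element.\<close>

lemma PIstar_singleton_iff:
  assumes P: "P \<in> PIstar X"
  shows "{u} \<in> P \<longleftrightarrow> u \<in> ground X \<and> (\<forall>L\<in>P. (\<forall>v. L \<noteq> {v}) \<longrightarrow> u \<notin> L)"
proof
  assume "{u} \<in> P"
  then show "u \<in> ground X \<and> (\<forall>L\<in>P. (\<forall>v. L \<noteq> {v}) \<longrightarrow> u \<notin> L)"
    using PIstar_block_subset[OF P, of "{u}"] PIstar_block_unique[OF P, of "{u}" _ u] by auto
next
  assume *: "u \<in> ground X \<and> (\<forall>L\<in>P. (\<forall>v. L \<noteq> {v}) \<longrightarrow> u \<notin> L)"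
  then obtain L where "L \<in> P" "u \<in> L" using PIstar_block[OF P, of u] by auto
  with * show "{u} \<in> P" by auto
qed

text \<open>Equal relations give the same lines, and these fix the singletons. Equations between
  elements are reduced by this to equations between relations.\<close>

lemma lrel_inj:
  assumes P: "P \<in> PIstar X" and Q: "Q \<in> PIstar X" and eq: "lrel X P = lrel X Q"
  shows "P = Q"
proof -
  have line_iff: "L \<in> P \<longleftrightarrow> L \<in> Q" if "\<And>u. L \<noteq> {u}" for L
    using lrel_line_subset[OF P Q eq] lrel_line_subset[OF Q P eq[symmetric]] that by metis
  then have "{u} \<in> P \<longleftrightarrow> {u} \<in> Q" for u
    unfolding PIstar_singleton_iff[OF P] PIstar_singleton_iff[OF Q] by metis
  with line_iff show ?thesis by (metis set_eq_iff)
qed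

section \<open>The product as relational composition\<close>

lemma equiv_gen_equiv: "equiv UNIV (gen_equiv P Q)"
proof (rule equivI)
  show "sym (gen_equiv P Q)"
    unfolding gen_equiv_def by (rule sym_rtrancl) (auto simp: sym_def)
qed (auto simp: gen_equiv_def refl_rtrancl trans_rtrancl)

lemma gen_equiv_sym: "(u, v) \<in> gen_equiv P Q \<Longrightarrow> (v, u) \<in> gen_equiv P Q"
  using equiv_gen_equiv by (meson equiv_def symE)

lemma gen_equiv_trans:
  "(u, v) \<in> gen_equiv P Q \<Longrightarrow> (v, w) \<in> gen_equiv P Q \<Longrightarrow> (u, w) \<in> gen_equiv P Q"
  using equiv_gen_equiv by (meson equiv_def transE)

lemma gen_equiv_refl: "(u, u) \<in> gen_equiv P Q"
  by (auto simp: gen_equiv_def)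

lemma gen_equiv_left:
  "L \<in> P \<Longrightarrow> u \<in> L \<Longrightarrow> v \<in> L \<Longrightarrow> (emb_left u, emb_left v) \<in> gen_equiv P Q"
  unfolding gen_equiv_def by (rule r_into_rtrancl) blast

lemma gen_equiv_right:
  "L \<in> Q \<Longrightarrow> u \<in> L \<Longrightarrow> v \<in> L \<Longrightarrow> (emb_right u, emb_right v) \<in> gen_equiv P Q"
  unfolding gen_equiv_def by (rule r_into_rtrancl) blast

text \<open>In the product, an outer point of a live class lies on a line and every other point
  becomes a singleton.\<close>

definition live :: "'a pt set set \<Rightarrow> 'a pt set set \<Rightarrow> 'a pt3 \<Rightarrow> bool" where
  "live P Q w \<longleftrightarrow> (\<forall>s\<in>singleton_pts P Q. (w, s) \<notin> gen_equiv P Q)"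

lemma live_cong: "(v, w) \<in> gen_equiv P Q \<Longrightarrow> live P Q v \<longleftrightarrow> live P Q w"
  unfolding live_def using gen_equiv_sym gen_equiv_trans by metis

lemma live_left: "live P Q (emb_left u) \<Longrightarrow> {u} \<notin> P"
  unfolding live_def singleton_pts_def using gen_equiv_refl by blast

lemma live_right: "live P Q (emb_right u) \<Longrightarrow> {u} \<notin> Q"
  unfolding live_def singleton_pts_def using gen_equiv_refl by blast

definition PIrel :: "'a set \<Rightarrow> 'a pt set set \<Rightarrow> 'a pt set set \<Rightarrow> ('a pt \<times> 'a pt) set" where
  "PIrel X P Q = {(u, v). u \<in> ground X \<and> v \<in> ground X \<and>
      (u = v \<or> ((emb_out u, emb_out v) \<in> gen_equiv P Q \<and> live P Q (emb_out u)))}"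

lemma PIprod_eq: "PIprod X P Q = ground X // PIrel X P Q"
  by (simp add: PIprod_def PIrel_def live_def)

lemma equiv_PIrel: "equiv (ground X) (PIrel X P Q)"
proof (rule equivI)
  show "PIrel X P Q \<subseteq> ground X \<times> ground X" "refl_on (ground X) (PIrel X P Q)"
    by (auto simp: PIrel_def refl_on_def)
  show "sym (PIrel X P Q)"
    unfolding PIrel_def sym_def using live_cong gen_equiv_sym by fastforce
  show "trans (PIrel X P Q)"
    unfolding PIrel_def trans_def using live_cong gen_equiv_trans by (smt (verit) case_prodD case_prodI mem_Collect_eq)
qed

lemma PIprod_block_live:
  "u \<in> ground X \<Longrightarrow> live P Q (emb_out u) \<Longrightarrow>
    PIrel X P Q `` {u} = {v \<in> ground X. (emb_out u, emb_out v) \<in> gen_equiv P Q}"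
  by (auto simp: PIrel_def gen_equiv_refl)

lemma PIprod_block_not_live:
  "u \<in> ground X \<Longrightarrow> \<not> live P Q (emb_out u) \<Longrightarrow> PIrel X P Q `` {u} = {u}"
  by (auto simp: PIrel_def)

text \<open>No block met by a live class is a singleton, so a line of \<open>P\<close> leads from
  \<open>x\<close> to the middle copy, and from there a line of \<open>Q\<close> leads to the third
  copy.\<close>

lemma live_Up_connected:
  assumes P: "P \<in> PIstar X" and Q: "Q \<in> PIstar X" and x: "x \<in> X" and live: "live P Q (T1 x)"
  obtains y z where "y \<in> X" "z \<in> X" "(T1 x, T2 y) \<in> gen_equiv P Q" "(T1 x, T3 z) \<in> gen_equiv P Q"
proof -
  obtain L where L: "L \<in> P" "Up x \<in> L" "L \<subseteq> ground X" using PIstar_block[OF P, of "Up x"] x by auto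
  then have "\<And>u. L \<noteq> {u}" using live_left[of P Q "Up x"] live by auto
  then obtain y where y: "Dn y \<in> L" using PIstar_line[OF P L(1)] by blast
  then have yX: "y \<in> X" and xy: "(T1 x, T2 y) \<in> gen_equiv P Q"
    using L gen_equiv_left[OF L(1,2) y, of Q] by auto
  obtain M where M: "M \<in> Q" "Up y \<in> M" "M \<subseteq> ground X" using PIstar_block[OF Q, of "Up y"] yX by auto
  then have "\<And>u. M \<noteq> {u}" using live_right[of P Q "Up y"] live live_cong[OF xy] by auto
  then obtain z where z: "Dn z \<in> M" using PIstar_line[OF Q M(1)] by blast
  then have "z \<in> X" "(T2 y, T3 z) \<in> gen_equiv P Q"
    using M gen_equiv_right[OF M(1,2) z, of P] by auto
  then show thesis using that yX xy gen_equiv_trans by metis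
qed

text \<open>The same walk in the opposite direction, along a line of \<open>Q\<close> and then a
  line of \<open>P\<close>.\<close>

lemma live_Dn_connected:
  assumes P: "P \<in> PIstar X" and Q: "Q \<in> PIstar X" and z: "z \<in> X" and live: "live P Q (T3 z)"
  obtains x where "x \<in> X" "(T3 z, T1 x) \<in> gen_equiv P Q"
proof -
  obtain L where L: "L \<in> Q" "Dn z \<in> L" "L \<subseteq> ground X" using PIstar_block[OF Q, of "Dn z"] z by auto
  then have "\<And>u. L \<noteq> {u}" using live_right[of P Q "Dn z"] live by auto
  then obtain y where y: "Up y \<in> L" using PIstar_line[OF Q L(1)] by blast
  then have yX: "y \<in> X" and zy: "(T3 z, T2 y) \<in> gen_equiv P Q"
    using L gen_equiv_right[OF L(1,2) y, of P] by auto
  obtain M where M: "M \<in> P" "Dn y \<in> M" "M \<subseteq> ground X" using PIstar_block[OF P, of "Dn y"] yX by auto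
  then have "\<And>u. M \<noteq> {u}" using live_left[of P Q "Dn y"] live live_cong[OF zy] by auto
  then obtain x where x: "Up x \<in> M" using PIstar_line[OF P M(1)] by blast
  then have "x \<in> X" "(T2 y, T1 x) \<in> gen_equiv P Q"
    using M gen_equiv_left[OF M(1,2) x, of Q] by auto
  then show thesis using that zy gen_equiv_trans by metis
qed

text \<open>First a point of \<open>X\<close> in the class is found, then the walk from it supplies
  a primed point. This is what keeps the product inside \<open>PIstar X\<close>.\<close>

lemma live_block_line:
  assumes P: "P \<in> PIstar X" and Q: "Q \<in> PIstar X" and u: "u \<in> ground X"
    and live: "live P Q (emb_out u)"
  shows "\<exists>x. Up x \<in> PIrel X P Q `` {u}" "\<exists>z. Dn z \<in> PIrel X P Q `` {u}"
proof -
  have *: "\<exists>x\<in>X. (emb_out u, T1 x) \<in> gen_equiv P Q"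
  proof (cases u)
    case (Up x) then show ?thesis using u gen_equiv_refl by auto
  next
    case (Dn z) then show ?thesis using live_Dn_connected[OF P Q] u live
      by (metis Dn_in_ground emb_out.simps(2))
  qed
  then obtain x where x: "x \<in> X" "(emb_out u, T1 x) \<in> gen_equiv P Q" by blast
  then have "live P Q (T1 x)" using live live_cong by blast
  then obtain z where "z \<in> X" "(T1 x, T3 z) \<in> gen_equiv P Q"
    using live_Up_connected[OF P Q x(1)] by blast
  then have z: "z \<in> X" "(emb_out u, T3 z) \<in> gen_equiv P Q" using x gen_equiv_trans by metis+
  show "\<exists>x. Up x \<in> PIrel X P Q `` {u}" "\<exists>z. Dn z \<in> PIrel X P Q `` {u}"
    using x z unfolding PIprod_block_live[OF u live] by auto
qed

lemma PIprod_closed: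
  assumes P: "P \<in> PIstar X" and Q: "Q \<in> PIstar X"
  shows "PIprod X P Q \<in> PIstar X"
proof -
  have "(\<exists>v. B = {v}) \<or> ((\<exists>x. Up x \<in> B) \<and> (\<exists>x. Dn x \<in> B))" if B: "B \<in> PIprod X P Q" for B
  proof -
    obtain u where u: "u \<in> ground X" "B = PIrel X P Q `` {u}"
      using B unfolding PIprod_eq by (rule quotientE)
    then show ?thesis
      using live_block_line[OF P Q, of u] PIprod_block_not_live[of u X P Q] by metis
  qed
  then show ?thesis
    using partition_on_quotient[OF equiv_PIrel] unfolding PIstar_def PIprod_eq by blast
qed

text \<open>The block through a live point is the trace of its \<open>gen_equiv\<close> class on the
  outer copies, and any other point forms a singleton. Saturation thus becomes a condition on the
  generated equivalence alone.\<close>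

lemma saturated_PIprod:
  assumes P: "P \<in> PIstar X" and Q: "Q \<in> PIstar X" and U: "U \<subseteq> ground X"
  shows "saturated (PIprod X P Q) U \<longleftrightarrow>
    (\<forall>u\<in>U. live P Q (emb_out u) \<and>
      (\<forall>v\<in>ground X. (emb_out u, emb_out v) \<in> gen_equiv P Q \<longrightarrow> v \<in> U))"
    (is "_ \<longleftrightarrow> ?R")
proof
  assume sat: "saturated (PIprod X P Q) U"
  show ?R
  proof
    fix u assume uU: "u \<in> U"
    let ?L = "PIrel X P Q `` {u}"
    have u: "u \<in> ground X" using uU U by auto
    then have "?L \<in> PIprod X P Q" unfolding PIprod_eq by (rule quotientI)
    moreover have "u \<in> ?L" using u equiv_PIrel by (rule equiv_class_self[rotated])
    ultimately have L: "?L \<subseteq> U" "?L \<noteq> {u}" using saturatedD[OF sat _ _ uU] by auto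
    then have live: "live P Q (emb_out u)" using PIprod_block_not_live[OF u] by blast
    then show "live P Q (emb_out u) \<and>
      (\<forall>v\<in>ground X. (emb_out u, emb_out v) \<in> gen_equiv P Q \<longrightarrow> v \<in> U)"
      using L PIprod_block_live[OF u live] by blast
  qed
next
  assume R: ?R
  show "saturated (PIprod X P Q) U"
  proof (rule saturatedI)
    fix L u assume L: "L \<in> PIprod X P Q" and u: "u \<in> L" "u \<in> U"
    then have ug: "u \<in> ground X" using U by auto
    have live: "live P Q (emb_out u)" using R u by auto
    obtain v where v: "v \<in> ground X" "L = PIrel X P Q `` {v}"
      using L unfolding PIprod_eq by (rule quotientE)
    then have "L = PIrel X P Q `` {u}"
      using equiv_class_eq[OF equiv_PIrel, of v u] u by simp
    then have L: "L = {v \<in> ground X. (emb_out u, emb_out v) \<in> gen_equiv P Q}"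
      "\<exists>x. Up x \<in> L" "\<exists>x. Dn x \<in> L"
      using PIprod_block_live[OF ug live] live_block_line[OF P Q ug live] by simp_all
    then have "L \<noteq> {v}" for v by (metis pt.distinct(1) singletonD)
    with L(1) R u show "L \<subseteq> U \<and> (\<forall>v. L \<noteq> {v})" by blast
  qed
qed

text \<open>Glueing \<open>pts A M\<close> and \<open>pts M B\<close> along the middle copy gives
  one subset of the triple ground set, whose traces under the embeddings are read off here.\<close>

lemma emb_in_glued:
  "emb_left u \<in> T1 ` A \<union> T2 ` M \<union> T3 ` B \<longleftrightarrow> u \<in> pts A M"
  "emb_right u \<in> T1 ` A \<union> T2 ` M \<union> T3 ` B \<longleftrightarrow> u \<in> pts M B"
  "emb_out u \<in> T1 ` A \<union> T2 ` M \<union> T3 ` B \<longleftrightarrow> u \<in> pts A B"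
  by (cases u; auto)+

text \<open>Induction along a chain of generators: each step stays in one block of \<open>P\<close>
  or \<open>Q\<close>, and a block that meets a saturated set lies inside it.\<close>

lemma glued_closed:
  assumes "saturated P (pts A M)" "saturated Q (pts M B)"
    and "w \<in> T1 ` A \<union> T2 ` M \<union> T3 ` B" "(w, w') \<in> gen_equiv P Q"
  shows "w' \<in> T1 ` A \<union> T2 ` M \<union> T3 ` B"
  using assms(4,3) unfolding gen_equiv_def
proof (induction rule: rtrancl_induct)
  case (step v w)
  let ?W = "T1 ` A \<union> T2 ` M \<union> T3 ` B"
  have v: "v \<in> ?W" using step.IH step.prems by simp
  from step.hyps(2) consider
    (1) L x y where "L \<in> P" "x \<in> L" "y \<in> L" "v = emb_left x" "w = emb_left y" |
    (2) L x y where "L \<in> Q" "x \<in> L" "y \<in> L" "v = emb_right x" "w = emb_right y"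
    by blast
  then show ?case
  proof cases
    case 1
    then show ?thesis using v emb_in_glued(1) saturatedD(1)[OF assms(1)] by (metis subsetD)
  next
    case 2
    then show ?thesis using v emb_in_glued(2) saturatedD(1)[OF assms(2)] by (metis subsetD)
  qed
qed

text \<open>A pair of the composite arises by glueing two saturated sets along \<open>M\<close>.
  Conversely \<open>M\<close> is recovered as the set of middle points connected to
  \<open>pts A B\<close>.\<close>

lemma lrel_PIprod:
  assumes P: "P \<in> PIstar X" and Q: "Q \<in> PIstar X"
  shows "lrel X (PIprod X P Q) = lrel X P O lrel X Q"
proof (intro equalityI subrelI)
  fix A B assume "(A, B) \<in> lrel X P O lrel X Q"
  then obtain M where AM: "(A, M) \<in> lrel X P" and MB: "(M, B) \<in> lrel X Q" by blast
  then have sP: "saturated P (pts A M)" and sQ: "saturated Q (pts M B)" and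
    sub: "A \<noteq> {}" "A \<subseteq> X" "M \<subseteq> X" "B \<subseteq> X" by (auto simp: lrel_def)
  let ?W = "T1 ` A \<union> T2 ` M \<union> T3 ` B"
  \<comment> \<open>Together with closedness of \<open>?W\<close> this makes every point of
    \<open>pts A B\<close> live.\<close>
  have nosing: "s \<notin> ?W" if s: "s \<in> singleton_pts P Q" for s
  proof -
    consider u where "{u} \<in> P" "s = emb_left u" | u where "{u} \<in> Q" "s = emb_right u"
      using s by (auto simp: singleton_pts_def)
    then show ?thesis
    proof cases
      case 1
      then show ?thesis using saturatedD(2)[OF sP _ singletonI] emb_in_glued(1) by metis
    next
      case 2
      then show ?thesis using saturatedD(2)[OF sQ _ singletonI] emb_in_glued(2) by metis
    qed
  qed
  have "saturated (PIprod X P Q) (pts A B)"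
  proof (subst saturated_PIprod[OF P Q], goal_cases)
    case 1 then show ?case using sub by (simp add: pts_subset_ground)
  next
    case 2
    show ?case
      using glued_closed[OF sP sQ] nosing emb_in_glued(3) unfolding live_def by metis
  qed
  then show "(A, B) \<in> lrel X (PIprod X P Q)" using sub by (auto simp: lrel_def)
next
  fix A B assume "(A, B) \<in> lrel X (PIprod X P Q)"
  then have sub: "A \<noteq> {}" "A \<subseteq> X" "B \<subseteq> X" and "saturated (PIprod X P Q) (pts A B)"
    by (auto simp: lrel_def)
  then have sat: "\<And>u. u \<in> pts A B \<Longrightarrow> live P Q (emb_out u)"
    "\<And>u v. u \<in> pts A B \<Longrightarrow> v \<in> ground X \<Longrightarrow> (emb_out u, emb_out v) \<in> gen_equiv P Q \<Longrightarrow> v \<in> pts A B"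
    using saturated_PIprod[OF P Q] by (auto simp: pts_subset_ground)
  have UpA: "x' \<in> A" if "u \<in> pts A B" "x' \<in> X" "(emb_out u, T1 x') \<in> gen_equiv P Q" for u x'
    using sat(2)[OF that(1), of "Up x'"] that by simp
  have DnB: "z \<in> B" if "u \<in> pts A B" "z \<in> X" "(emb_out u, T3 z) \<in> gen_equiv P Q" for u z
    using sat(2)[OF that(1), of "Dn z"] that by simp
  define M where "M = {y\<in>X. \<exists>u\<in>pts A B. (emb_out u, T2 y) \<in> gen_equiv P Q}"
  have "saturated P (pts A M)"
  proof (rule saturatedI)
    fix L v assume L: "L \<in> P" and v: "v \<in> L" "v \<in> pts A M"
    have "\<exists>u\<in>pts A B. (emb_out u, emb_left v) \<in> gen_equiv P Q"
    proof (cases v)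
      case (Up x) then show ?thesis using v gen_equiv_refl
        by (metis Up_in_pts emb_left.simps(1) emb_out.simps(1))
    qed (use v in \<open>auto simp: M_def\<close>)
    then obtain u where u: "u \<in> pts A B" "(emb_out u, emb_left v) \<in> gen_equiv P Q" by blast
    then have "live P Q (emb_left v)" using sat(1) live_cong by blast
    then have "{v} \<notin> P" by (rule live_left)
    moreover have "w \<in> pts A M" if "w \<in> L" for w
    proof -
      have "(emb_out u, emb_left w) \<in> gen_equiv P Q"
        using gen_equiv_trans[OF u(2) gen_equiv_left[OF L v(1) that]] .
      moreover have "w \<in> ground X" using PIstar_block_subset[OF P L] that by blast
      ultimately show ?thesis using UpA u(1) by (cases w) (auto simp: M_def)
    qed
    ultimately show "L \<subseteq> pts A M \<and> (\<forall>u. L \<noteq> {u})" using L v by auto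
  qed
  moreover have "saturated Q (pts M B)"
  proof (rule saturatedI)
    fix L v assume L: "L \<in> Q" and v: "v \<in> L" "v \<in> pts M B"
    have "\<exists>u\<in>pts A B. (emb_out u, emb_right v) \<in> gen_equiv P Q"
    proof (cases v)
      case (Dn x) then show ?thesis using v gen_equiv_refl
        by (metis Dn_in_pts emb_right.simps(2) emb_out.simps(2))
    qed (use v in \<open>auto simp: M_def\<close>)
    then obtain u where u: "u \<in> pts A B" "(emb_out u, emb_right v) \<in> gen_equiv P Q" by blast
    then have "live P Q (emb_right v)" using sat(1) live_cong by blast
    then have "{v} \<notin> Q" by (rule live_right)
    moreover have "w \<in> pts M B" if "w \<in> L" for w
    proof -
      have "(emb_out u, emb_right w) \<in> gen_equiv P Q"
        using gen_equiv_trans[OF u(2) gen_equiv_right[OF L v(1) that]] .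
      moreover have "w \<in> ground X" using PIstar_block_subset[OF Q L] that by blast
      ultimately show ?thesis using DnB u(1) by (cases w) (auto simp: M_def)
    qed
    ultimately show "L \<subseteq> pts M B \<and> (\<forall>u. L \<noteq> {u})" using L v by auto
  qed
  \<comment> \<open>\<open>lrel\<close> admits \<open>(M, B)\<close> only for nonempty
    \<open>M\<close>; a middle point is reached from any point of \<open>A\<close>.\<close>
  moreover have "M \<noteq> {}"
  proof -
    obtain x where x: "x \<in> A" "x \<in> X" using sub by blast
    then have "live P Q (T1 x)" using sat(1)[of "Up x"] by simp
    then obtain y where "y \<in> X" "(T1 x, T2 y) \<in> gen_equiv P Q"
      using live_Up_connected[OF P Q x(2)] by blast
    then have "y \<in> M" using x unfolding M_def by (auto intro!: bexI[of _ "Up x"])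
    then show ?thesis by blast
  qed
  ultimately show "(A, B) \<in> lrel X P O lrel X Q"
    using sub by (auto simp: lrel_def M_def intro!: relcompI[of A M])
qed

section \<open>Relations as injective partial maps on nonempty subsets\<close>

abbreviation nes :: "'a set \<Rightarrow> 'a set set" where
  "nes X \<equiv> Pow X - {{}}"

lemma lrel_in_nes:
  assumes "P \<in> PIstar X" "(A, B) \<in> lrel X P"
  shows "A \<in> nes X" "B \<in> nes X"
  using assms lrel_rng_nonempty[OF assms] by (auto simp: lrel_def)

text \<open>The line through a point of \<open>A\<close> has a primed point in \<open>B\<close>; it
  therefore meets \<open>pts C B\<close>, lies inside it, and puts the point into
  \<open>C\<close>.\<close>

lemma lrel_dom_subset:
  assumes P: "P \<in> PIstar X" and AB: "(A, B) \<in> lrel X P" and CB: "(C, B) \<in> lrel X P"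
  shows "A \<subseteq> C"
proof
  fix x assume x: "x \<in> A"
  have sat: "saturated P (pts A B)" "saturated P (pts C B)" and "x \<in> X"
    using AB CB x by (auto simp: lrel_def)
  then obtain L where L: "L \<in> P" "Up x \<in> L" using PIstar_block[OF P, of "Up x"] by auto
  have LA: "L \<subseteq> pts A B" "\<And>v. L \<noteq> {v}"
    using saturatedD[OF sat(1) L] x by auto
  then obtain y where "Dn y \<in> L" using PIstar_line(2)[OF P L(1)] by blast
  moreover from this have "y \<in> B" using LA(1) by (metis Dn_in_pts subsetD)
  ultimately have "L \<subseteq> pts C B" using saturatedD(1)[OF sat(2) L(1), of "Dn y"] by simp
  then show "x \<in> C" using L by (metis Up_in_pts subsetD)
qed

lemma lrel_rng_subset:
  assumes P: "P \<in> PIstar X" and AB: "(A, B) \<in> lrel X P" and AD: "(A, D) \<in> lrel X P"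
  shows "B \<subseteq> D"
proof
  fix y assume y: "y \<in> B"
  have sat: "saturated P (pts A B)" "saturated P (pts A D)" and "y \<in> X"
    using AB AD y by (auto simp: lrel_def)
  then obtain L where L: "L \<in> P" "Dn y \<in> L" using PIstar_block[OF P, of "Dn y"] by auto
  have LA: "L \<subseteq> pts A B" "\<And>v. L \<noteq> {v}"
    using saturatedD[OF sat(1) L] y by auto
  then obtain x where "Up x \<in> L" using PIstar_line(1)[OF P L(1)] by blast
  moreover from this have "x \<in> A" using LA(1) by (metis Up_in_pts subsetD)
  ultimately have "L \<subseteq> pts A D" using saturatedD(1)[OF sat(2) L(1), of "Up x"] by simp
  then show "y \<in> D" using L by (metis Dn_in_pts subsetD)
qed

lemma lrel_dom_unique:
  "P \<in> PIstar X \<Longrightarrow> (A, B) \<in> lrel X P \<Longrightarrow> (C, B) \<in> lrel X P \<Longrightarrow> A = C"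
  by (simp add: lrel_dom_subset subset_antisym)

lemma lrel_rng_unique:
  "P \<in> PIstar X \<Longrightarrow> (A, B) \<in> lrel X P \<Longrightarrow> (A, D) \<in> lrel X P \<Longrightarrow> B = D"
  by (simp add: lrel_rng_subset subset_antisym)

section \<open>Elements given by their lines\<close>

text \<open>An element with prescribed disjoint lines is unique, because all points off the lines
  must be singletons. Constructions therefore only list their lines.\<close>

definition fill :: "'a set \<Rightarrow> 'a pt set set \<Rightarrow> 'a pt set set" where
  "fill X C = C \<union> {{u} | u. u \<in> ground X \<and> u \<notin> \<Union>C}"

definition disjoint_lines :: "'a set \<Rightarrow> 'a pt set set \<Rightarrow> bool" where
  "disjoint_lines X C \<longleftrightarrow>
    disjoint C \<and> (\<forall>L\<in>C. L \<subseteq> ground X \<and> (\<exists>x. Up x \<in> L) \<and> (\<exists>x. Dn x \<in> L))"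

lemma disjoint_linesD:
  assumes "disjoint_lines X C" "L \<in> C"
  shows "L \<subseteq> ground X" "\<exists>x. Up x \<in> L" "\<exists>x. Dn x \<in> L" "L \<noteq> {v}"
    "M \<in> C \<Longrightarrow> u \<in> L \<Longrightarrow> u \<in> M \<Longrightarrow> L = M"
proof -
  show *: "L \<subseteq> ground X" "\<exists>x. Up x \<in> L" "\<exists>x. Dn x \<in> L"
    using assms by (auto simp: disjoint_lines_def)
  show "L \<noteq> {v}" using *(2,3) by (metis pt.distinct(1) singletonD)
  show "L = M" if "M \<in> C" "u \<in> L" "u \<in> M"
    using assms that by (auto simp: disjoint_lines_def pairwise_def disjnt_def)
qed

lemma fill_PIstar:
  assumes C: "disjoint_lines X C"
  shows "fill X C \<in> PIstar X"
proof -
  have "partition_on (ground X) (fill X C)"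
  proof (rule partition_onI)
    have "\<Union>C \<subseteq> ground X" using disjoint_linesD(1)[OF C] by (rule Union_least)
    moreover have "\<Union>{{u} | u. u \<in> ground X \<and> u \<notin> \<Union>C} = ground X - \<Union>C" by blast
    ultimately show "\<Union>(fill X C) = ground X"
      unfolding fill_def Union_Un_distrib by (simp add: Un_absorb1)
    show "{} \<notin> fill X C"
      using disjoint_linesD(2)[OF C] by (auto simp: fill_def)
    show "disjnt L M" if "L \<in> fill X C" "M \<in> fill X C" "L \<noteq> M" for L M
      using that disjoint_linesD(5)[OF C] by (auto simp: fill_def disjnt_def)
  qed
  moreover have "(\<exists>u. L = {u}) \<or> ((\<exists>x. Up x \<in> L) \<and> (\<exists>x. Dn x \<in> L))" if "L \<in> fill X C" for L
    using that disjoint_linesD(2,3)[OF C] by (auto simp: fill_def)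
  ultimately show ?thesis by (simp add: PIstar_def)
qed

text \<open>A point of a saturated set is no singleton block, so it lies in a member of
  \<open>C\<close>, which is then contained in the set.\<close>

lemma saturated_fill:
  assumes C: "disjoint_lines X C" and U: "U \<subseteq> ground X"
  shows "saturated (fill X C) U \<longleftrightarrow> (\<exists>D\<in>Pow C. U = \<Union>D)"
proof
  assume sat: "saturated (fill X C) U"
  have "u \<in> \<Union>{L\<in>C. L \<subseteq> U}" if u: "u \<in> U" for u
  proof -
    have "{u} \<notin> fill X C" using saturatedD(2)[OF sat _ singletonI u] by auto
    then obtain L where L: "L \<in> C" "u \<in> L" using u U by (auto simp: fill_def)
    then have "L \<subseteq> U" using saturatedD(1)[OF sat _ L(2) u] by (auto simp: fill_def)
    then show ?thesis using L by auto
  qed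
  then have "U = \<Union>{L\<in>C. L \<subseteq> U}" by auto
  then show "\<exists>D\<in>Pow C. U = \<Union>D" by (intro bexI[of _ "{L\<in>C. L \<subseteq> U}"]) auto
next
  assume "\<exists>D\<in>Pow C. U = \<Union>D"
  then obtain D where D: "D \<subseteq> C" "U = \<Union>D" by auto
  show "saturated (fill X C) U"
  proof (rule saturatedI)
    fix L u assume L: "L \<in> fill X C" "u \<in> L" "u \<in> U"
    then obtain M where M: "M \<in> D" "u \<in> M" using D by auto
    then have "L \<in> C" using L D by (auto simp: fill_def)
    moreover from this have "L = M" using disjoint_linesD(5)[OF C _ _ L(2)] M D by auto
    ultimately show "L \<subseteq> U \<and> (\<forall>v. L \<noteq> {v})" using disjoint_linesD(4)[OF C] M D by auto
  qed
qed

lemma lrel_fill: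
  assumes "disjoint_lines X C"
  shows "(A, B) \<in> lrel X (fill X C) \<longleftrightarrow> A \<in> nes X \<and> B \<subseteq> X \<and> (\<exists>D\<in>Pow C. pts A B = \<Union>D)"
  using saturated_fill[OF assms, of "pts A B"] by (auto simp: lrel_def pts_subset_ground)

section \<open>The zero, rank-one elements, swaps and permutations\<close>

definition null_elt :: "'a set \<Rightarrow> 'a pt set set" where
  "null_elt X = fill X {}"

definition rank1 :: "'a set \<Rightarrow> 'a set \<Rightarrow> 'a set \<Rightarrow> 'a pt set set" where
  "rank1 X A B = fill X {pts A B}"

definition swap :: "'a set \<Rightarrow> 'a set \<Rightarrow> 'a set \<Rightarrow> 'a pt set set" where
  "swap X A B = fill X {pts A B, pts B A}"

lemma pts_eq_empty [simp]: "pts A B = {} \<longleftrightarrow> A = {} \<and> B = {}"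
  by (auto simp: pts_def)

lemma null_elt_PIstar [simp]: "null_elt X \<in> PIstar X"
  unfolding null_elt_def by (rule fill_PIstar) (simp add: disjoint_lines_def)

text \<open>The empty relation absorbs under composition, so this element is the zero of the
  monoid.\<close>

lemma lrel_null_elt: "lrel X (null_elt X) = {}"
proof -
  have "disjoint_lines X {}" by (simp add: disjoint_lines_def)
  then have "(A, B) \<notin> lrel X (null_elt X)" for A B
    unfolding null_elt_def by (subst lrel_fill) auto
  then show ?thesis by auto
qed

lemma rank1_lines: "A \<in> nes X \<Longrightarrow> B \<in> nes X \<Longrightarrow> disjoint_lines X {pts A B}"
  by (auto simp: disjoint_lines_def pts_subset_ground)

lemma rank1_PIstar: "A \<in> nes X \<Longrightarrow> B \<in> nes X \<Longrightarrow> rank1 X A B \<in> PIstar X"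
  unfolding rank1_def by (intro fill_PIstar rank1_lines)

lemma lrel_rank1:
  assumes "A \<in> nes X" "B \<in> nes X"
  shows "lrel X (rank1 X A B) = {(A, B)}"
proof -
  have "(C, D) \<in> lrel X (rank1 X A B) \<longleftrightarrow> (C, D) = (A, B)" for C D
    using assms lrel_fill[OF rank1_lines[OF assms], of C D]
    by (simp add: rank1_def Pow_insert) metis
  then show ?thesis by auto
qed

lemma swap_lines:
  assumes "A \<in> nes X" "B \<in> nes X" "A \<inter> B = {}"
  shows "disjoint_lines X {pts A B, pts B A}"
  using assms by (auto simp: disjoint_lines_def pts_subset_ground pairwise_insert disjnt_def pts_Int Int_commute)

lemma swap_PIstar:
  "A \<in> nes X \<Longrightarrow> B \<in> nes X \<Longrightarrow> A \<inter> B = {} \<Longrightarrow> swap X A B \<in> PIstar X"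
  unfolding swap_def by (intro fill_PIstar swap_lines)

text \<open>Two disjoint lines have three nonempty unions, of which only the full one has equal
  components.\<close>

lemma lrel_swap:
  assumes "A \<in> nes X" "B \<in> nes X" "A \<inter> B = {}"
  shows "lrel X (swap X A B) = {(A, B), (B, A), (A \<union> B, A \<union> B)}"
proof -
  have Pow2: "Pow {K, L} = {{}, {K}, {L}, {K, L}}" for K L :: "'a pt set"
    by (auto simp: Pow_insert)
  have "(C, D) \<in> lrel X (swap X A B) \<longleftrightarrow> C \<in> nes X \<and> D \<subseteq> X \<and>
      ((C, D) = (A, B) \<or> (C, D) = (B, A) \<or> (C, D) = (A \<union> B, A \<union> B))" for C D
    unfolding swap_def lrel_fill[OF swap_lines[OF assms]] Pow2
    by (auto simp: pts_Un Un_commute)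
  moreover have "A \<union> B \<in> nes X" using assms by auto
  ultimately show ?thesis using assms by (intro equalityI subrelI; simp; blast)
qed

lemma perm_elt_lines:
  assumes p: "bij_betw p X X"
  shows "disjoint_lines X (perm_elt X p)"
proof -
  have "x \<in> X \<Longrightarrow> p x \<in> X" for x using p by (auto simp: bij_betw_def)
  moreover have "x \<in> X \<Longrightarrow> y \<in> X \<Longrightarrow> p x = p y \<Longrightarrow> x = y" for x y
    using p by (auto simp: bij_betw_def inj_on_def)
  ultimately show ?thesis
    by (auto simp: disjoint_lines_def perm_elt_def pairwise_def disjnt_def)
qed

lemma perm_elt_eq_fill:
  assumes p: "bij_betw p X X"
  shows "fill X (perm_elt X p) = perm_elt X p"
proof -
  have "u \<in> \<Union>(perm_elt X p)" if "u \<in> ground X" for u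
    using that p by (cases u) (auto simp: perm_elt_def bij_betw_def)
  then show ?thesis by (auto simp: fill_def)
qed

lemma perm_elt_PIstar: "bij_betw p X X \<Longrightarrow> perm_elt X p \<in> PIstar X"
  using fill_PIstar[OF perm_elt_lines[of p X]] by (simp add: perm_elt_eq_fill)

text \<open>The lines tie each \<open>x\<close> to \<open>p x\<close>, so a union of lines is fixed
  by its part in \<open>X\<close>; the relation is the graph of the direct image map on nonempty
  subsets.\<close>

lemma lrel_perm_elt:
  assumes p: "bij_betw p X X"
  shows "lrel X (perm_elt X p) = {(A, p ` A) | A. A \<in> nes X}"
proof -
  have "(A, B) \<in> lrel X (perm_elt X p) \<longleftrightarrow> A \<in> nes X \<and> B = p ` A" for A B
  proof -
    have "(A, B) \<in> lrel X (perm_elt X p) \<longleftrightarrow>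
        A \<in> nes X \<and> B \<subseteq> X \<and> (\<exists>D\<in>Pow (perm_elt X p). pts A B = \<Union>D)"
      using lrel_fill[OF perm_elt_lines[OF p]] by (simp add: perm_elt_eq_fill[OF p])
    also have "(\<exists>D\<in>Pow (perm_elt X p). pts A B = \<Union>D) \<longleftrightarrow> A \<subseteq> X \<and> B = p ` A"
    proof
      assume "\<exists>D\<in>Pow (perm_elt X p). pts A B = \<Union>D"
      then obtain D where D: "D \<subseteq> perm_elt X p" "pts A B = \<Union>D" by auto
      have "x \<in> X \<and> p x \<in> B" if "x \<in> A" for x
      proof -
        have "Up x \<in> \<Union>D" using that by (simp flip: D(2))
        then obtain L where L: "L \<in> D" "Up x \<in> L" by auto
        then have "x \<in> X" "Dn (p x) \<in> L" using D by (auto simp: perm_elt_def)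
        then have "Dn (p x) \<in> pts A B" using D L by blast
        then show ?thesis using \<open>x \<in> X\<close> by simp
      qed
      moreover have "y \<in> p ` A" if "y \<in> B" for y
      proof -
        have "Dn y \<in> \<Union>D" using that by (simp flip: D(2))
        then obtain L where L: "L \<in> D" "Dn y \<in> L" by auto
        then obtain x where "y = p x" "Up x \<in> L" using D by (auto simp: perm_elt_def)
        moreover from this have "Up x \<in> pts A B" using D L by blast
        ultimately show ?thesis by simp
      qed
      ultimately show "A \<subseteq> X \<and> B = p ` A" by auto
    next
      assume "A \<subseteq> X \<and> B = p ` A"
      \<comment> \<open>The subfamily consists of the lines that start in \<open>A\<close>.\<close>
      then show "\<exists>D\<in>Pow (perm_elt X p). pts A B = \<Union>D"
        by (intro bexI[of _ "perm_elt A p"]) (auto simp: perm_elt_def pts_def)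
    qed
    finally show ?thesis using p by (auto simp: bij_betw_def)
  qed
  then show ?thesis by auto
qed

section \<open>Monoid laws, the symmetric group and its conjugations\<close>

lemma PIid_eq: "PIid X = perm_elt X id"
  by (simp add: PIid_def perm_elt_def)

lemma PIid_PIstar: "PIid X \<in> PIstar X"
  unfolding PIid_eq by (rule perm_elt_PIstar) (rule bij_betw_id)

lemma lrel_PIid: "lrel X (PIid X) = Id_on (nes X)"
  unfolding PIid_eq by (subst lrel_perm_elt) (auto simp: bij_betw_id)

text \<open>Associativity and the unit laws are inherited from relational composition through
  injectivity of \<open>lrel\<close>.\<close>

lemma monoid_PI_monoid: "monoid (PI_monoid X)"
proof (rule monoidI, goal_cases)
  case (1 x y) then show ?case by (simp add: PI_monoid_def PIprod_closed)
next
  case 2 then show ?case by (simp add: PI_monoid_def PIid_PIstar)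
next
  case (3 x y z) then show ?case
    by (simp add: PI_monoid_def)
      (rule lrel_inj[where X = X]; simp add: PIprod_closed lrel_PIprod O_assoc)
next
  case (4 x)
  then show ?case using lrel_in_nes[of x X]
    by (simp add: PI_monoid_def)
      (rule lrel_inj[where X = X]; force simp add: PIprod_closed lrel_PIprod PIid_PIstar lrel_PIid)
next
  case (5 x)
  then show ?case using lrel_in_nes[of x X]
    by (simp add: PI_monoid_def)
      (rule lrel_inj[where X = X]; force simp add: PIprod_closed lrel_PIprod PIid_PIstar lrel_PIid)
qed

lemma carrier_PI [simp]: "carrier (PI_monoid X) = PIstar X"
  and mult_PI [simp]: "mult (PI_monoid X) = PIprod X"
  and one_PI [simp]: "one (PI_monoid X) = PIid X"
  by (simp_all add: PI_monoid_def)

text \<open>Relational composition runs from left to right, so \<open>p\<close> acts first.\<close>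

lemma perm_elt_mult:
  assumes p: "bij_betw p X X" and q: "bij_betw q X X"
  shows "PIprod X (perm_elt X p) (perm_elt X q) = perm_elt X (q \<circ> p)"
proof (rule lrel_inj)
  have qp: "bij_betw (q \<circ> p) X X" using p q by (rule bij_betw_trans)
  show "PIprod X (perm_elt X p) (perm_elt X q) \<in> PIstar X" "perm_elt X (q \<circ> p) \<in> PIstar X"
    using p q qp by (simp_all add: PIprod_closed perm_elt_PIstar)
  have "p ` A \<in> nes X" if "A \<in> nes X" for A using p that by (auto simp: bij_betw_def)
  then have "{(A, p ` A) | A. A \<in> nes X} O {(A, q ` A) | A. A \<in> nes X} =
      {(A, (q \<circ> p) ` A) | A. A \<in> nes X}"
    unfolding image_comp[symmetric] by (intro equalityI subrelI) blast+
  then show "lrel X (PIprod X (perm_elt X p) (perm_elt X q)) = lrel X (perm_elt X (q \<circ> p))"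
    using p q qp by (simp add: lrel_PIprod perm_elt_PIstar lrel_perm_elt)
qed

lemma perm_elt_cong: "(\<And>x. x \<in> X \<Longrightarrow> p x = q x) \<Longrightarrow> perm_elt X p = perm_elt X q"
  by (force simp: perm_elt_def)

lemma perm_elt_inverse:
  assumes p: "bij_betw p X X"
  shows "PIprod X (perm_elt X p) (perm_elt X (inv_into X p)) = PIid X"
    and "PIprod X (perm_elt X (inv_into X p)) (perm_elt X p) = PIid X"
  using p bij_betw_inv_into[OF p]
  by (auto simp: perm_elt_mult PIid_eq bij_betw_inv_into_left bij_betw_inv_into_right
      intro!: perm_elt_cong)

lemma inv_perm_elt:
  assumes p: "bij_betw p X X"
  shows "inv\<^bsub>PI_monoid X\<^esub> (perm_elt X p) = perm_elt X (inv_into X p)"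
  using monoid.inv_unique'[OF monoid_PI_monoid, of "perm_elt X p" X "perm_elt X (inv_into X p)"]
    perm_elt_inverse[OF p] p bij_betw_inv_into[OF p] by (simp add: perm_elt_PIstar)

lemma perm_elt_Units: "bij_betw p X X \<Longrightarrow> perm_elt X p \<in> Units (PI_monoid X)"
  using perm_elt_inverse[of p X] perm_elt_PIstar[of p X]
    perm_elt_PIstar[OF bij_betw_inv_into[of p X X]]
  by (auto simp: Units_def)

text \<open>Used to invert the final isomorphism, which is constructed out of
  \<open>SX_group X\<close>.\<close>

lemma group_SX_group: "group (SX_group X)"
proof (rule groupI)
  interpret monoid "PI_monoid X" by (rule monoid_PI_monoid)
  have S: "x \<in> SX X \<Longrightarrow> x \<in> PIstar X" for x by (auto simp: SX_def perm_elt_PIstar)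
  show "x \<otimes>\<^bsub>SX_group X\<^esub> y \<in> carrier (SX_group X)"
    if "x \<in> carrier (SX_group X)" "y \<in> carrier (SX_group X)" for x y
    using that by (auto simp: SX_group_def SX_def perm_elt_mult) (metis bij_betw_trans)
  show "\<one>\<^bsub>SX_group X\<^esub> \<in> carrier (SX_group X)"
    using bij_betw_id by (auto simp: SX_group_def SX_def PIid_eq)
  show "x \<otimes>\<^bsub>SX_group X\<^esub> y \<otimes>\<^bsub>SX_group X\<^esub> z = x \<otimes>\<^bsub>SX_group X\<^esub> (y \<otimes>\<^bsub>SX_group X\<^esub> z)"
    if "x \<in> carrier (SX_group X)" "y \<in> carrier (SX_group X)" "z \<in> carrier (SX_group X)" for x y z
    using that S m_assoc by (simp add: SX_group_def)
  show "\<one>\<^bsub>SX_group X\<^esub> \<otimes>\<^bsub>SX_group X\<^esub> x = x" if "x \<in> carrier (SX_group X)" for x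
    using that S l_one by (simp add: SX_group_def)
  show "\<exists>y\<in>carrier (SX_group X). y \<otimes>\<^bsub>SX_group X\<^esub> x = \<one>\<^bsub>SX_group X\<^esub>"
    if "x \<in> carrier (SX_group X)" for x
    using that by (auto simp: SX_group_def SX_def) (metis bij_betw_inv_into perm_elt_inverse(2))
qed

text \<open>The left factor pulls a set back along \<open>p\<close> and the right factor pushes the
  result forward, so both components are transported by direct image.\<close>

lemma lrel_conj_perm:
  assumes p: "bij_betw p X X" and P: "P \<in> PIstar X"
  shows "lrel X (PIprod X (PIprod X (inv\<^bsub>PI_monoid X\<^esub> (perm_elt X p)) P) (perm_elt X p)) =
    {(p ` A, p ` B) | A B. (A, B) \<in> lrel X P}"
proof -
  let ?q = "inv_into X p"
  have q: "bij_betw ?q X X" using p by (rule bij_betw_inv_into)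
  have pq: "p ` ?q ` A = A" if "A \<subseteq> X" for A
    using p that by (auto simp: bij_betw_def image_inv_into_cancel)
  have qp: "?q ` p ` A = A" if "A \<subseteq> X" for A
    using p that by (simp add: bij_betw_def inv_into_image_cancel)
  have pn: "p ` A \<in> nes X" if "A \<in> nes X" for A using p that by (auto simp: bij_betw_def)
  have "lrel X (PIprod X (PIprod X (inv\<^bsub>PI_monoid X\<^esub> (perm_elt X p)) P) (perm_elt X p)) =
    {(A, ?q ` A) | A. A \<in> nes X} O lrel X P O {(A, p ` A) | A. A \<in> nes X}"
    using p q P by (simp add: inv_perm_elt lrel_PIprod PIprod_closed perm_elt_PIstar lrel_perm_elt O_assoc)
  also have "\<dots> = {(p ` A, p ` B) | A B. (A, B) \<in> lrel X P}" (is "?L = ?R")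
  proof (intro equalityI subrelI)
    fix A B assume "(A, B) \<in> ?L"
    then obtain D where D: "A \<in> nes X" "(?q ` A, D) \<in> lrel X P" "B = p ` D" by auto
    then have "A = p ` ?q ` A" using pq by auto
    then show "(A, B) \<in> ?R" using D by blast
  next
    fix A B assume "(A, B) \<in> ?R"
    then obtain C D where CD: "(C, D) \<in> lrel X P" "A = p ` C" "B = p ` D" by auto
    then have n: "C \<in> nes X" "D \<in> nes X" using lrel_in_nes[OF P] by auto
    then have "C = ?q ` A" "A \<in> nes X" using CD qp pn by auto
    then show "(A, B) \<in> ?L" using CD n by blast
  qed
  finally show ?thesis .
qed

section \<open>Conjugation by units in an arbitrary monoid\<close>

lemma (in monoid) conj_auto:
  assumes u: "u \<in> Units G"
  shows "(\<lambda>a\<in>carrier G. u \<otimes> a \<otimes> inv u) \<in> auto G"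
proof -
  have c: "u \<in> carrier G" "inv u \<in> carrier G" using u by auto
  have canc: "inv u \<otimes> (u \<otimes> a) = a" "u \<otimes> (inv u \<otimes> a) = a" if "a \<in> carrier G" for a
    using u c that by (simp_all flip: m_assoc)
  have "bij_betw (\<lambda>a. u \<otimes> a \<otimes> inv u) (carrier G) (carrier G)"
    by (rule bij_betw_byWitness[where f' = "\<lambda>a. inv u \<otimes> a \<otimes> u"])
      (use u c canc in \<open>auto simp: m_assoc\<close>)
  then show ?thesis
    using u c canc by (auto simp: auto_def hom_def Bij_def m_assoc)
qed

lemma (in monoid) inv_mult_Units:
  assumes u: "u \<in> Units G" and v: "v \<in> Units G"
  shows "inv (u \<otimes> v) = inv v \<otimes> inv u"
proof (rule inv_unique'[symmetric])
  have c: "u \<in> carrier G" "inv u \<in> carrier G" "v \<in> carrier G" "inv v \<in> carrier G"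
    using u v by auto
  then show "u \<otimes> v \<in> carrier G" "inv v \<otimes> inv u \<in> carrier G" by auto
  have "v \<otimes> (inv v \<otimes> inv u) = inv u" "inv u \<otimes> (u \<otimes> v) = v"
    using u v c by (simp_all flip: m_assoc)
  then show "u \<otimes> v \<otimes> (inv v \<otimes> inv u) = \<one>" "inv v \<otimes> inv u \<otimes> (u \<otimes> v) = \<one>"
    using u v c by (simp_all add: m_assoc)
qed

text \<open>With the inverse on the right, composing conjugations multiplies the units in the same
  order.\<close>

lemma (in monoid) conj_compose:
  assumes u: "u \<in> Units G" and v: "v \<in> Units G"
  shows "compose (carrier G) (\<lambda>a\<in>carrier G. u \<otimes> a \<otimes> inv u) (\<lambda>a\<in>carrier G. v \<otimes> a \<otimes> inv v) =
    (\<lambda>a\<in>carrier G. (u \<otimes> v) \<otimes> a \<otimes> inv (u \<otimes> v))"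
proof -
  have c: "u \<in> carrier G" "inv u \<in> carrier G" "v \<in> carrier G" "inv v \<in> carrier G"
    using u v by auto
  then have "u \<otimes> (v \<otimes> a \<otimes> inv v) \<otimes> inv u = (u \<otimes> v) \<otimes> a \<otimes> inv (u \<otimes> v)"
    if "a \<in> carrier G" for a
    using u v that by (simp add: m_assoc inv_mult_Units)
  then show ?thesis using c by (simp add: compose_def fun_eq_iff)
qed

section \<open>Products with rank-one elements\<close>

lemma lrel_rank1_sandwich:
  assumes "A \<in> nes X" "B \<in> nes X" "C \<in> nes X" "D \<in> nes X" "P \<in> PIstar X"
  shows "lrel X (PIprod X (PIprod X (rank1 X A B) P) (rank1 X C D)) =
    (if (B, C) \<in> lrel X P then {(A, D)} else {})"
  using assms by (auto simp: lrel_PIprod PIprod_closed rank1_PIstar lrel_rank1)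

text \<open>Rank-one elements multiply like matrix units indexed by nonempty subsets.\<close>

lemma rank1_mult:
  assumes "A \<in> nes X" "B \<in> nes X" "C \<in> nes X" "D \<in> nes X"
  shows "PIprod X (rank1 X A B) (rank1 X C D) = (if B = C then rank1 X A D else null_elt X)"
proof (rule lrel_inj[where X = X])
  show "lrel X (PIprod X (rank1 X A B) (rank1 X C D)) =
      lrel X (if B = C then rank1 X A D else null_elt X)"
    unfolding lrel_PIprod[OF rank1_PIstar[OF assms(1,2)] rank1_PIstar[OF assms(3,4)]]
      lrel_rank1[OF assms(1,2)] lrel_rank1[OF assms(3,4)]
    using lrel_rank1[OF assms(1,4)] by (auto simp: lrel_null_elt)
qed (use assms in \<open>simp_all add: PIprod_closed rank1_PIstar\<close>)

lemma rank1_eq_iff: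
  assumes "A \<in> nes X" "B \<in> nes X" "C \<in> nes X" "D \<in> nes X"
  shows "rank1 X A B = rank1 X C D \<longleftrightarrow> A = C \<and> B = D"
proof
  assume "rank1 X A B = rank1 X C D"
  then have "{(A, B)} = {(C, D)}" using lrel_rank1 assms by metis
  then show "A = C \<and> B = D" by simp
qed simp

lemma PIstar_eqI_rank1:
  assumes "P \<in> PIstar X" "A \<in> nes X" "B \<in> nes X" "lrel X P = {(A, B)}"
  shows "P = rank1 X A B"
  by (rule lrel_inj[where X = X]) (simp_all only: assms rank1_PIstar lrel_rank1)

lemma PIstar_eq_null_iff: "P \<in> PIstar X \<Longrightarrow> P = null_elt X \<longleftrightarrow> lrel X P = {}"
  using lrel_inj[of P X "null_elt X"] lrel_null_elt[of X] null_elt_PIstar[of X] by metis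

lemma rank1_neq_null: "A \<in> nes X \<Longrightarrow> B \<in> nes X \<Longrightarrow> rank1 X A B \<noteq> null_elt X"
  by (metis lrel_rank1 lrel_null_elt insert_not_empty)

lemma null_elt_mult: "P \<in> PIstar X \<Longrightarrow> PIprod X (null_elt X) P = null_elt X"
  by (subst PIstar_eq_null_iff) (simp_all add: PIprod_closed lrel_PIprod lrel_null_elt)

section \<open>Automorphisms\<close>

text \<open>Phrased through the product and the zero alone, so that automorphisms preserve
  it.\<close>

definition is_rank1 :: "'a set \<Rightarrow> 'a pt set set \<Rightarrow> bool" where
  "is_rank1 X P \<longleftrightarrow> P \<in> PIstar X \<and> P \<noteq> null_elt X \<and>
    (\<forall>Q\<in>PIstar X. PIprod X (PIprod X P Q) P \<in> {null_elt X, P})"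

text \<open>The sandwiched product depends only on whether \<open>(B, A)\<close> belongs to the
  relation of \<open>Q\<close>.\<close>

lemma is_rank1_rank1:
  assumes n: "A \<in> nes X" "B \<in> nes X"
  shows "is_rank1 X (rank1 X A B)"
proof -
  let ?P = "rank1 X A B"
  have "PIprod X (PIprod X ?P Q) ?P \<in> {null_elt X, ?P}" if Q: "Q \<in> PIstar X" for Q
  proof -
    let ?S = "PIprod X (PIprod X ?P Q) ?P"
    have S: "?S \<in> PIstar X" by (intro PIprod_closed rank1_PIstar n Q)
    show ?thesis
    proof (cases "(B, A) \<in> lrel X Q")
      case True
      then have "lrel X ?S = {(A, B)}" by (simp only: lrel_rank1_sandwich[OF n n Q] if_True)
      then have "?S = ?P" by (rule PIstar_eqI_rank1[OF S n])
      then show ?thesis by (rule ssubst) (rule insertI2, rule singletonI)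
    next
      case False
      then have "lrel X ?S = {}" by (simp only: lrel_rank1_sandwich[OF n n Q] if_False)
      then have "?S = null_elt X" by (simp only: PIstar_eq_null_iff[OF S])
      then show ?thesis by (rule ssubst) (rule insertI1)
    qed
  qed
  then show ?thesis
    using rank1_PIstar[OF n] rank1_neq_null[OF n] unfolding is_rank1_def by blast
qed

text \<open>For a pair \<open>(A, B)\<close> of the relation, take \<open>rank1 X B A\<close> as
  test element. Since each component of a pair determines the other, the sandwich has
  \<open>(A, B)\<close> as its only pair; being nonzero, it equals \<open>P\<close>.\<close>

lemma is_rank1_imp_lrel:
  assumes P: "is_rank1 X P"
  shows "\<exists>A\<in>nes X. \<exists>B\<in>nes X. lrel X P = {(A, B)}"
proof -
  have PX: "P \<in> PIstar X" and "P \<noteq> null_elt X"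
    and sand: "\<And>Q. Q \<in> PIstar X \<Longrightarrow> PIprod X (PIprod X P Q) P \<in> {null_elt X, P}"
    using P unfolding is_rank1_def by blast+
  then have "lrel X P \<noteq> {}" using PIstar_eq_null_iff by metis
  then obtain A B where AB: "(A, B) \<in> lrel X P" by fast
  have n: "A \<in> nes X" "B \<in> nes X" using lrel_in_nes[OF PX AB] .
  have R: "rank1 X B A \<in> PIstar X" by (rule rank1_PIstar[OF n(2,1)])
  let ?Q = "PIprod X (PIprod X P (rank1 X B A)) P"
  have "lrel X ?Q = (lrel X P O {(B, A)}) O lrel X P"
    unfolding lrel_PIprod[OF PIprod_closed[OF PX R] PX] lrel_PIprod[OF PX R] lrel_rank1[OF n(2,1)] ..
  also have "\<dots> = {(A, B)}"
  proof (intro equalityI subrelI)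
    fix C D assume "(C, D) \<in> (lrel X P O {(B, A)}) O lrel X P"
    then have CB: "(C, B) \<in> lrel X P" and AD: "(A, D) \<in> lrel X P" by blast+
    from lrel_dom_unique[OF PX AB CB] lrel_rng_unique[OF PX AB AD]
    show "(C, D) \<in> {(A, B)}" by simp
  next
    fix C D assume "(C, D) \<in> {(A, B)}"
    then show "(C, D) \<in> (lrel X P O {(B, A)}) O lrel X P" using AB by blast
  qed
  finally have *: "lrel X ?Q = {(A, B)}" .
  then have "?Q \<noteq> null_elt X" by (metis lrel_null_elt insert_not_empty)
  then have "?Q = P" using sand[OF R] by blast
  then show ?thesis using * n by metis
qed

lemma is_rank1_iff: "is_rank1 X P \<longleftrightarrow> (\<exists>A\<in>nes X. \<exists>B\<in>nes X. P = rank1 X A B)"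
proof
  assume P: "is_rank1 X P"
  then obtain A B where "A \<in> nes X" "B \<in> nes X" "lrel X P = {(A, B)}"
    using is_rank1_imp_lrel by meson
  moreover from P have "P \<in> PIstar X" by (simp only: is_rank1_def)
  ultimately show "\<exists>A\<in>nes X. \<exists>B\<in>nes X. P = rank1 X A B"
    using PIstar_eqI_rank1 by metis
next
  assume "\<exists>A\<in>nes X. \<exists>B\<in>nes X. P = rank1 X A B"
  then show "is_rank1 X P" using is_rank1_rank1 by metis
qed

locale PI_automorphism =
  fixes X :: "'a set" and \<phi> :: "'a pt set set \<Rightarrow> 'a pt set set"
  assumes auto: "\<phi> \<in> auto (PI_monoid X)"
begin

lemma bij: "bij_betw \<phi> (PIstar X) (PIstar X)"
  using auto by (simp add: auto_def Bij_def)

lemma closed: "P \<in> PIstar X \<Longrightarrow> \<phi> P \<in> PIstar X"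
  using bij by (auto simp: bij_betw_def)

lemma mult: "P \<in> PIstar X \<Longrightarrow> Q \<in> PIstar X \<Longrightarrow> \<phi> (PIprod X P Q) = PIprod X (\<phi> P) (\<phi> Q)"
  using auto by (simp add: auto_def hom_def)

lemma eq_iff: "P \<in> PIstar X \<Longrightarrow> Q \<in> PIstar X \<Longrightarrow> \<phi> P = \<phi> Q \<longleftrightarrow> P = Q"
  using bij by (auto simp: bij_betw_def inj_on_def)

lemma surj: "Q \<in> PIstar X \<Longrightarrow> \<exists>P\<in>PIstar X. \<phi> P = Q"
  using bij unfolding bij_betw_def by (metis imageE)

lemma null [simp]: "\<phi> (null_elt X) = null_elt X"
proof -
  obtain P where P: "P \<in> PIstar X" "\<phi> P = null_elt X" using surj[of "null_elt X"] by auto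
  \<comment> \<open>Zero absorbs, so a preimage of zero may be inserted in the middle;
    \<open>\<phi>\<close> turns that preimage into zero.\<close>
  have "\<phi> (null_elt X) = \<phi> (PIprod X (PIprod X (null_elt X) P) (null_elt X))"
    using P by (simp add: null_elt_mult)
  also have "\<dots> = PIprod X (PIprod X (\<phi> (null_elt X)) (null_elt X)) (\<phi> (null_elt X))"
    using P by (simp add: mult PIprod_closed)
  also have "\<dots> = null_elt X"
    using closed[of "null_elt X"]
    by (subst PIstar_eq_null_iff) (simp_all add: PIprod_closed lrel_PIprod lrel_null_elt)
  finally show ?thesis .
qed

text \<open>Surjectivity lets the test elements range over images, and injectivity pulls the
  resulting equations back.\<close>

lemma is_rank1_image: "P \<in> PIstar X \<Longrightarrow> is_rank1 X (\<phi> P) \<longleftrightarrow> is_rank1 X P"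
proof -
  assume P: "P \<in> PIstar X"
  have sand: "PIprod X (PIprod X (\<phi> P) (\<phi> Q)) (\<phi> P) \<in> {null_elt X, \<phi> P} \<longleftrightarrow>
      PIprod X (PIprod X P Q) P \<in> {null_elt X, P}" if Q: "Q \<in> PIstar X" for Q
  proof -
    let ?S = "PIprod X (PIprod X P Q) P"
    have S: "?S \<in> PIstar X" by (intro PIprod_closed P Q)
    have "PIprod X (PIprod X (\<phi> P) (\<phi> Q)) (\<phi> P) = \<phi> ?S"
      by (simp only: mult P Q PIprod_closed)
    moreover have "\<phi> ?S = null_elt X \<longleftrightarrow> ?S = null_elt X"
      using eq_iff[OF S null_elt_PIstar] by simp
    ultimately show ?thesis using eq_iff[OF S P] by simp
  qed
  have "(\<forall>Q\<in>PIstar X. PIprod X (PIprod X (\<phi> P) Q) (\<phi> P) \<in> {null_elt X, \<phi> P}) \<longleftrightarrow>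
      (\<forall>Q\<in>\<phi> ` PIstar X. PIprod X (PIprod X (\<phi> P) Q) (\<phi> P) \<in> {null_elt X, \<phi> P})"
    using bij by (simp only: bij_betw_def)
  also have "\<dots> \<longleftrightarrow> (\<forall>Q\<in>PIstar X. PIprod X (PIprod X P Q) P \<in> {null_elt X, P})"
    using sand by (simp only: ball_simps(9) cong: ball_cong)
  finally show ?thesis
    using P closed[OF P] eq_iff[OF P null_elt_PIstar] unfolding is_rank1_def by simp
qed

section \<open>The induced map on nonempty subsets\<close>

lemma image_rank1_ex:
  "A \<in> nes X \<Longrightarrow> B \<in> nes X \<Longrightarrow> \<exists>P\<in>nes X. \<exists>Q\<in>nes X. \<phi> (rank1 X A B) = rank1 X P Q"
  using is_rank1_image[OF rank1_PIstar] is_rank1_iff by metis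

text \<open>The idempotents of rank one are the elements \<open>rank1 X A A\<close>, so permuting
  them amounts to a map on nonempty subsets. By \<open>rank1_eq_iff\<close> the choice is unique for
  nonempty \<open>A\<close> inside \<open>X\<close>.\<close>

definition \<theta> :: "'a set \<Rightarrow> 'a set" where
  "\<theta> A = (SOME P. P \<in> nes X \<and> \<phi> (rank1 X A A) = rank1 X P P)"

text \<open>The image of an idempotent is idempotent, whereas \<open>rank1 X P Q\<close> with
  distinct indices has square zero.\<close>

lemma \<theta>:
  assumes A: "A \<in> nes X"
  shows "\<theta> A \<in> nes X" "\<phi> (rank1 X A A) = rank1 X (\<theta> A) (\<theta> A)"
proof -
  obtain P Q where PQ: "P \<in> nes X" "Q \<in> nes X" "\<phi> (rank1 X A A) = rank1 X P Q"
    using image_rank1_ex[OF A A] by blast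
  have "rank1 X P Q = PIprod X (rank1 X P Q) (rank1 X P Q)"
    using mult[of "rank1 X A A" "rank1 X A A"] A by (simp add: rank1_PIstar rank1_mult flip: PQ(3))
  then have "P = Q"
    using rank1_mult[OF PQ(1,2) PQ(1,2)] rank1_neq_null[OF PQ(1,2)] by (metis (no_types))
  then have "\<exists>P. P \<in> nes X \<and> \<phi> (rank1 X A A) = rank1 X P P" using PQ by blast
  from someI_ex[OF this] show "\<theta> A \<in> nes X" "\<phi> (rank1 X A A) = rank1 X (\<theta> A) (\<theta> A)"
    unfolding \<theta>_def by blast+
qed

text \<open>Multiplying by \<open>rank1 X A A\<close> on the left and \<open>rank1 X B B\<close> on
  the right fixes \<open>rank1 X A B\<close>. In the image a mismatch of indices would give zero,
  which forces both indices.\<close>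

lemma image_rank1:
  assumes A: "A \<in> nes X" and B: "B \<in> nes X"
  shows "\<phi> (rank1 X A B) = rank1 X (\<theta> A) (\<theta> B)"
proof -
  obtain P Q where PQ: "P \<in> nes X" "Q \<in> nes X" "\<phi> (rank1 X A B) = rank1 X P Q"
    using image_rank1_ex[OF A B] by blast
  have "rank1 X P Q = PIprod X (rank1 X (\<theta> A) (\<theta> A)) (rank1 X P Q)"
    using mult[of "rank1 X A A" "rank1 X A B"] A B \<theta>
    by (simp add: rank1_PIstar rank1_mult flip: PQ(3))
  then have "P = \<theta> A"
    using rank1_mult[OF \<theta>(1)[OF A] \<theta>(1)[OF A] PQ(1,2)] rank1_neq_null[OF PQ(1,2)] by metis
  moreover have "rank1 X P Q = PIprod X (rank1 X P Q) (rank1 X (\<theta> B) (\<theta> B))"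
    using mult[of "rank1 X A B" "rank1 X B B"] A B \<theta>
    by (simp add: rank1_PIstar rank1_mult flip: PQ(3))
  then have "Q = \<theta> B"
    using rank1_mult[OF PQ(1,2) \<theta>(1)[OF B] \<theta>(1)[OF B]] rank1_neq_null[OF PQ(1,2)] by metis
  ultimately show ?thesis using PQ by simp
qed

lemma \<theta>_eq_iff: "A \<in> nes X \<Longrightarrow> B \<in> nes X \<Longrightarrow> \<theta> A = \<theta> B \<longleftrightarrow> A = B"
  using image_rank1[of A A] image_rank1[of B B] eq_iff[of "rank1 X A A" "rank1 X B B"]
    rank1_eq_iff[of A X A B B] rank1_PIstar by metis

text \<open>A preimage of \<open>rank1 X P P\<close> under \<open>\<phi>\<close> has rank one, and
  its first index is sent to \<open>P\<close>.\<close>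

lemma \<theta>_surj:
  assumes P: "P \<in> nes X"
  shows "\<exists>A\<in>nes X. \<theta> A = P"
proof -
  obtain R where R: "R \<in> PIstar X" "\<phi> R = rank1 X P P" using surj[OF rank1_PIstar[OF P P]] by blast
  then have "is_rank1 X R" using is_rank1_image is_rank1_iff P by metis
  then obtain A B where AB: "A \<in> nes X" "B \<in> nes X" "R = rank1 X A B"
    unfolding is_rank1_iff by blast
  then have "rank1 X (\<theta> A) (\<theta> B) = rank1 X P P" using R image_rank1 by simp
  then show ?thesis using rank1_eq_iff \<theta>(1) AB P by metis
qed

text \<open>A pair belongs to the relation iff the sandwich between two rank-one idempotents is
  nonzero, which \<open>\<phi>\<close> preserves.\<close>

lemma image_lrel_iff:
  assumes A: "A \<in> nes X" and B: "B \<in> nes X" and P: "P \<in> PIstar X"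
  shows "(\<theta> A, \<theta> B) \<in> lrel X (\<phi> P) \<longleftrightarrow> (A, B) \<in> lrel X P"
proof -
  let ?S = "\<lambda>A B P. PIprod X (PIprod X (rank1 X A A) P) (rank1 X B B)"
  have *: "(A, B) \<in> lrel X P \<longleftrightarrow> ?S A B P \<noteq> null_elt X"
    if "A \<in> nes X" "B \<in> nes X" "P \<in> PIstar X" for A B P
    using that lrel_rank1_sandwich[OF that(1,1,2,2,3)]
    by (subst PIstar_eq_null_iff) (auto simp: PIprod_closed rank1_PIstar)
  have "?S (\<theta> A) (\<theta> B) (\<phi> P) = \<phi> (?S A B P)"
    using A B P by (simp add: mult PIprod_closed rank1_PIstar image_rank1)
  moreover have "?S A B P \<in> PIstar X" using A B P by (simp add: PIprod_closed rank1_PIstar)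
  ultimately show ?thesis
    using *[OF A B P] *[OF \<theta>(1)[OF A] \<theta>(1)[OF B] closed[OF P]]
      eq_iff[of "?S A B P" "null_elt X"] by simp
qed

lemma image_lrel:
  assumes P: "P \<in> PIstar X"
  shows "lrel X (\<phi> P) = {(\<theta> A, \<theta> B) | A B. (A, B) \<in> lrel X P}"
proof (intro equalityI subrelI)
  fix C D assume CD: "(C, D) \<in> lrel X (\<phi> P)"
  then obtain A B where "A \<in> nes X" "B \<in> nes X" "C = \<theta> A" "D = \<theta> B"
    using lrel_in_nes[OF closed[OF P] CD] \<theta>_surj by metis
  then show "(C, D) \<in> {(\<theta> A, \<theta> B) | A B. (A, B) \<in> lrel X P}"
    using CD image_lrel_iff[of A B P] P by blast
next
  fix C D assume "(C, D) \<in> {(\<theta> A, \<theta> B) | A B. (A, B) \<in> lrel X P}"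
  then obtain A B where "(A, B) \<in> lrel X P" "C = \<theta> A" "D = \<theta> B" by blast
  then show "(C, D) \<in> lrel X (\<phi> P)"
    using lrel_in_nes[OF P] image_lrel_iff[OF _ _ P] by simp
qed

text \<open>In the image of \<open>swap X A B\<close> the two pairs exchanging
  \<open>\<theta> A\<close> and \<open>\<theta> B\<close> have distinct components. Their union, and
  their intersection if nonempty, have equal components and so must be \<open>(?C, ?C)\<close>. If
  both occurred, \<open>\<theta> A\<close> and \<open>\<theta> B\<close> would coincide.\<close>

lemma \<theta>_disjoint_Un:
  assumes A: "A \<in> nes X" and B: "B \<in> nes X" and disj: "A \<inter> B = {}"
  shows "\<theta> A \<inter> \<theta> B = {}" "\<theta> (A \<union> B) = \<theta> A \<union> \<theta> B"
proof -
  let ?C = "\<theta> (A \<union> B)" and ?R = "lrel X (\<phi> (swap X A B))"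
  have R: "?R = {(\<theta> A, \<theta> B), (\<theta> B, \<theta> A), (?C, ?C)}"
    using image_lrel[OF swap_PIstar[OF assms]] by (auto simp: lrel_swap[OF assms])
  have ne: "\<theta> A \<noteq> \<theta> B" using \<theta>_eq_iff A B disj by auto
  have mem: "(\<theta> A, \<theta> B) \<in> ?R" "(\<theta> B, \<theta> A) \<in> ?R" by (simp_all add: R)
  have "(\<theta> A \<union> \<theta> B, \<theta> A \<union> \<theta> B) \<in> ?R" using lrel_Un[OF mem] by (simp add: Un_commute)
  then show C: "?C = \<theta> A \<union> \<theta> B" using ne unfolding R by auto
  show "\<theta> A \<inter> \<theta> B = {}"
  proof (rule ccontr)
    assume "\<theta> A \<inter> \<theta> B \<noteq> {}"
    then have "(\<theta> A \<inter> \<theta> B, \<theta> A \<inter> \<theta> B) \<in> ?R" using lrel_Int[OF mem] by (simp add: Int_commute)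
    then have "?C = \<theta> A \<inter> \<theta> B" using ne unfolding R by auto
    with C ne show False by blast
  qed
qed

text \<open>For proper inclusions, \<open>B\<close> is the disjoint union of \<open>A\<close> and
  \<open>B - A\<close>.\<close>

lemma \<theta>_mono:
  assumes A: "A \<in> nes X" and B: "B \<in> nes X" and "A \<subseteq> B"
  shows "\<theta> A \<subseteq> \<theta> B"
proof (cases "A = B")
  case False
  then have "B - A \<in> nes X" "A \<inter> (B - A) = {}" using B \<open>A \<subseteq> B\<close> by auto
  then have "\<theta> (A \<union> (B - A)) = \<theta> A \<union> \<theta> (B - A)" by (rule \<theta>_disjoint_Un(2)[OF A])
  then show ?thesis using \<open>A \<subseteq> B\<close> by (simp add: Un_absorb1)
qed simp

text \<open>As disjointness is preserved, \<open>D\<close> meets \<open>A\<close> in some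
  \<open>x\<close>. Monotonicity squeezes \<open>\<theta> {x}\<close> into \<open>{y}\<close>, and
  injectivity gives \<open>D = {x}\<close>. This both sends points to points and locates the points
  of \<open>\<theta> A\<close>.\<close>

lemma \<theta>_singleton:
  assumes D: "D \<in> nes X" "\<theta> D = {y}" and A: "A \<in> nes X" "y \<in> \<theta> A"
  shows "\<exists>x\<in>A. D = {x}"
proof -
  have "\<theta> D \<inter> \<theta> A \<noteq> {}" using A(2) by (simp add: D(2))
  then have "D \<inter> A \<noteq> {}" using \<theta>_disjoint_Un(1)[OF D(1) A(1)] by metis
  then obtain x where x: "x \<in> D" "x \<in> A" by blast
  then have n: "{x} \<in> nes X" using D(1) by blast
  have "\<theta> {x} \<subseteq> {y}" using \<theta>_mono[OF n D(1)] x(1) by (simp add: D(2))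
  moreover have "\<theta> {x} \<noteq> {}" using \<theta>(1)[OF n] by blast
  ultimately have "\<theta> {x} = {y}" by (metis subset_singletonD)
  then have "{x} = D" using \<theta>_eq_iff[OF n D(1)] D(2) by metis
  then show ?thesis using x(2) by metis
qed

lemma \<theta>_point:
  assumes x: "x \<in> X"
  shows "\<exists>y\<in>X. \<theta> {x} = {y}"
proof -
  have n: "{x} \<in> nes X" using x by blast
  then obtain y where y: "y \<in> \<theta> {x}" "y \<in> X" using \<theta>(1)[OF n] by blast
  then have "{y} \<in> nes X" by blast
  then obtain D where D: "D \<in> nes X" "\<theta> D = {y}" using \<theta>_surj by metis
  then have "D = {x}" using \<theta>_singleton[OF D n y(1)] by (metis singletonD)
  then show ?thesis using D(2) y(2) by metis
qed

section \<open>The underlying permutation of \<open>X\<close>\<close>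

definition q :: "'a \<Rightarrow> 'a" where
  "q x = the_elem (\<theta> {x})"

lemma q: "x \<in> X \<Longrightarrow> \<theta> {x} = {q x}" "x \<in> X \<Longrightarrow> q x \<in> X"
  using \<theta>_point[of x] unfolding q_def by (metis the_elem_eq)+

text \<open>Points of \<open>\<theta> A\<close> come from points of \<open>A\<close> by
  \<open>\<theta>_singleton\<close>; the other inclusion is monotonicity.\<close>

lemma \<theta>_eq_image:
  assumes A: "A \<in> nes X"
  shows "\<theta> A = q ` A"
proof (intro equalityI subsetI)
  fix y assume y: "y \<in> \<theta> A"
  then have "{y} \<in> nes X" using \<theta>(1)[OF A] by blast
  then obtain D where D: "D \<in> nes X" "\<theta> D = {y}" using \<theta>_surj by metis
  then obtain x where x: "x \<in> A" "D = {x}" using \<theta>_singleton[OF D A y] by blast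
  then have "x \<in> X" using A by blast
  then have "y = q x" using D(2) q(1) x(2) by (metis singleton_inject)
  then show "y \<in> q ` A" using x(1) by (rule image_eqI)
next
  fix y assume "y \<in> q ` A"
  then obtain x where x: "x \<in> A" "y = q x" by blast
  then have xX: "x \<in> X" using A by blast
  then have "\<theta> {x} \<subseteq> \<theta> A" using A x(1) by (intro \<theta>_mono) simp_all
  then show "y \<in> \<theta> A" by (simp add: q(1)[OF xX] x(2))
qed

lemma bij_q: "bij_betw q X X"
proof (rule bij_betw_imageI)
  show "inj_on q X"
  proof (rule inj_onI)
    fix x y assume xy: "x \<in> X" "y \<in> X" "q x = q y"
    then have "\<theta> {x} = \<theta> {y}" by (simp only: q(1))
    then show "x = y" using \<theta>_eq_iff[of "{x}" "{y}"] xy(1,2) by simp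
  qed
  show "q ` X = X"
  \<comment> \<open>Surjectivity of \<open>\<theta>\<close> concerns nonempty sets; when
    \<open>X\<close> is nonempty it is applied to \<open>X\<close> itself.\<close>
  proof (cases "X = {}")
    case False
    then have "X \<in> nes X" by simp
    then obtain A where A: "A \<in> nes X" "\<theta> A = X" using \<theta>_surj by metis
    then have "X = q ` A" using \<theta>_eq_image[OF A(1)] by simp
    then have "X \<subseteq> q ` X" using A(1) by blast
    then show ?thesis using q(2) by blast
  qed simp
qed

text \<open>Both sides carry \<open>lrel X P\<close> along direct images under
  \<open>q\<close>.\<close>

lemma inner:
  assumes P: "P \<in> PIstar X"
  shows "\<phi> P = PIprod X (PIprod X (inv\<^bsub>PI_monoid X\<^esub> (perm_elt X q)) P) (perm_elt X q)"
proof (rule lrel_inj)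
  have "\<theta> A = q ` A \<and> \<theta> B = q ` B" if "(A, B) \<in> lrel X P" for A B
    using lrel_in_nes[OF P that] \<theta>_eq_image by blast
  then have "lrel X (\<phi> P) = {(q ` A, q ` B) | A B. (A, B) \<in> lrel X P}"
    unfolding image_lrel[OF P] by (intro Collect_cong) metis
  then show "lrel X (\<phi> P) =
      lrel X (PIprod X (PIprod X (inv\<^bsub>PI_monoid X\<^esub> (perm_elt X q)) P) (perm_elt X q))"
    using lrel_conj_perm[OF bij_q P] by simp
qed (use P bij_q closed bij_betw_inv_into[OF bij_q] in
    \<open>simp_all add: inv_perm_elt PIprod_closed perm_elt_PIstar\<close>)

end

section \<open>The automorphism group\<close>

text \<open>The inverse stands on the right, so that products go to composites; the theorem has it
  on the left. The map is restricted because members of \<open>auto\<close> are extensional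
  functions.\<close>

definition conj_map :: "'a set \<Rightarrow> 'a pt set set \<Rightarrow> 'a pt set set \<Rightarrow> 'a pt set set" where
  "conj_map X \<pi> = (\<lambda>P\<in>PIstar X. PIprod X (PIprod X \<pi> P) (inv\<^bsub>PI_monoid X\<^esub> \<pi>))"

lemma SX_Units: "\<pi> \<in> SX X \<Longrightarrow> \<pi> \<in> Units (PI_monoid X)"
  unfolding SX_def using perm_elt_Units by blast

lemma conj_map_auto: "\<pi> \<in> SX X \<Longrightarrow> conj_map X \<pi> \<in> auto (PI_monoid X)"
  using monoid.conj_auto[OF monoid_PI_monoid, of \<pi> X] SX_Units[of \<pi> X]
  by (simp add: conj_map_def)

lemma inv_SX: "\<pi> \<in> SX X \<Longrightarrow> inv\<^bsub>PI_monoid X\<^esub> \<pi> \<in> SX X"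
  unfolding SX_def using inv_perm_elt bij_betw_inv_into by fastforce

lemma inv_inv_SX: "\<pi> \<in> SX X \<Longrightarrow> inv\<^bsub>PI_monoid X\<^esub> (inv\<^bsub>PI_monoid X\<^esub> \<pi>) = \<pi>"
  by (rule monoid.Units_inv_inv[OF monoid_PI_monoid SX_Units])

text \<open>The permutation can be read off pointwise: conjugation by the inverse of
  \<open>perm_elt X r\<close> moves \<open>rank1 X {x} {x}\<close> to
  \<open>rank1 X {r x} {r x}\<close>.\<close>

lemma inj_conj_map: "inj_on (conj_map X) (SX X)"
proof (rule inj_onI)
  fix \<pi> \<sigma> assume \<pi>\<sigma>: "\<pi> \<in> SX X" "\<sigma> \<in> SX X" and eq: "conj_map X \<pi> = conj_map X \<sigma>"
  obtain p where p: "bij_betw p X X" "inv\<^bsub>PI_monoid X\<^esub> \<pi> = perm_elt X p"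
    using inv_SX[OF \<pi>\<sigma>(1)] by (auto simp: SX_def)
  obtain s where s: "bij_betw s X X" "inv\<^bsub>PI_monoid X\<^esub> \<sigma> = perm_elt X s"
    using inv_SX[OF \<pi>\<sigma>(2)] by (auto simp: SX_def)
  have \<pi>: "\<pi> = inv\<^bsub>PI_monoid X\<^esub> (perm_elt X p)" and \<sigma>: "\<sigma> = inv\<^bsub>PI_monoid X\<^esub> (perm_elt X s)"
    using inv_inv_SX \<pi>\<sigma> p s by metis+
  have conj: "conj_map X (inv\<^bsub>PI_monoid X\<^esub> (perm_elt X r)) (rank1 X {x} {x}) =
      rank1 X {r x} {r x}" if r: "bij_betw r X X" and x: "x \<in> X" for r x
  proof -
    have n: "{x} \<in> nes X" "{r x} \<in> nes X" using x r by (auto simp: bij_betw_def)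
    have inv: "inv\<^bsub>PI_monoid X\<^esub> (inv\<^bsub>PI_monoid X\<^esub> (perm_elt X r)) = perm_elt X r"
      by (rule inv_inv_SX) (use r in \<open>auto simp: SX_def\<close>)
    show ?thesis
    proof (rule PIstar_eqI_rank1)
      show "lrel X (conj_map X (inv\<^bsub>PI_monoid X\<^esub> (perm_elt X r)) (rank1 X {x} {x})) =
          {({r x}, {r x})}"
        using lrel_conj_perm[OF r rank1_PIstar[OF n(1,1)]]
        by (simp add: conj_map_def inv rank1_PIstar[OF n(1,1)] lrel_rank1[OF n(1,1)])
      show "conj_map X (inv\<^bsub>PI_monoid X\<^esub> (perm_elt X r)) (rank1 X {x} {x}) \<in> PIstar X"
        using r bij_betw_inv_into[OF r] rank1_PIstar[OF n(1,1)]
        by (simp add: conj_map_def inv) (simp add: inv_perm_elt PIprod_closed perm_elt_PIstar)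
    qed (use n in auto)
  qed
  have "p x = s x" if x: "x \<in> X" for x
  proof -
    have "{p x} \<in> nes X" "{s x} \<in> nes X" using p s x by (auto simp: bij_betw_def)
    moreover have "rank1 X {p x} {p x} = rank1 X {s x} {s x}"
      using conj[OF p(1) x] conj[OF s(1) x] eq \<pi> \<sigma> by simp
    ultimately show ?thesis using rank1_eq_iff by (metis singleton_inject)
  qed
  then have "perm_elt X p = perm_elt X s" by (rule perm_elt_cong)
  then show "\<pi> = \<sigma>" using \<pi> \<sigma> by simp
qed

theorem mainTheorem15:
  fixes X :: "'a set"
  shows "AutoGroup (PI_monoid X) \<cong> SX_group X \<and>
    (\<forall>\<phi>\<in>auto (PI_monoid X). \<exists>\<pi>\<in>SX X. \<forall>a\<in>PIstar X.
        \<phi> a = PIprod X (PIprod X (inv\<^bsub>PI_monoid X\<^esub> \<pi>) a) \<pi>)"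
proof
  show inner: "\<forall>\<phi>\<in>auto (PI_monoid X). \<exists>\<pi>\<in>SX X. \<forall>a\<in>PIstar X.
        \<phi> a = PIprod X (PIprod X (inv\<^bsub>PI_monoid X\<^esub> \<pi>) a) \<pi>"
  proof
    fix \<phi> assume "\<phi> \<in> auto (PI_monoid X)"
    then interpret PI_automorphism X \<phi> by unfold_locales
    have "perm_elt X q \<in> SX X" using bij_q by (auto simp: SX_def)
    then show "\<exists>\<pi>\<in>SX X. \<forall>a\<in>PIstar X. \<phi> a = PIprod X (PIprod X (inv\<^bsub>PI_monoid X\<^esub> \<pi>) a) \<pi>"
      by (rule bexI[rotated]) (rule ballI, rule inner)
  qed
  have surj: "conj_map X ` SX X = auto (PI_monoid X)"
  proof (intro equalityI subsetI)
    fix \<phi> assume \<phi>: "\<phi> \<in> auto (PI_monoid X)"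
    then obtain \<pi> where \<pi>: "\<pi> \<in> SX X"
      "\<And>a. a \<in> PIstar X \<Longrightarrow> \<phi> a = PIprod X (PIprod X (inv\<^bsub>PI_monoid X\<^esub> \<pi>) a) \<pi>"
      using inner by meson
    \<comment> \<open>Passing to the inverse switches between the two conventions for
      conjugation.\<close>
    have "\<phi> = conj_map X (inv\<^bsub>PI_monoid X\<^esub> \<pi>)"
    proof (rule extensionalityI)
      show "\<phi> \<in> extensional (PIstar X)" using \<phi> by (simp add: auto_def Bij_def)
      show "conj_map X (inv\<^bsub>PI_monoid X\<^esub> \<pi>) \<in> extensional (PIstar X)"
        by (simp add: conj_map_def)
      show "\<phi> a = conj_map X (inv\<^bsub>PI_monoid X\<^esub> \<pi>) a" if "a \<in> PIstar X" for a
        using that \<pi>(2)[OF that] by (simp only: conj_map_def restrict_apply inv_inv_SX[OF \<pi>(1)] if_True)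
    qed
    then show "\<phi> \<in> conj_map X ` SX X" using inv_SX[OF \<pi>(1)] by (rule image_eqI)
  next
    fix \<phi> assume "\<phi> \<in> conj_map X ` SX X"
    then show "\<phi> \<in> auto (PI_monoid X)" using conj_map_auto by (elim imageE) simp
  qed
  have mult: "conj_map X (PIprod X \<pi> \<sigma>) = compose (PIstar X) (conj_map X \<pi>) (conj_map X \<sigma>)"
    if "\<pi> \<in> SX X" "\<sigma> \<in> SX X" for \<pi> \<sigma>
  proof -
    have "\<pi> \<in> Units (PI_monoid X)" "\<sigma> \<in> Units (PI_monoid X)"
      using that by (simp_all add: SX_Units)
    from monoid.conj_compose[OF monoid_PI_monoid this] show ?thesis by (simp add: conj_map_def)
  qed
  have "conj_map X \<in> iso (SX_group X) (AutoGroup (PI_monoid X))"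
  proof (rule isoI)
    have "conj_map X \<pi> \<in> Bij (PIstar X)" if "\<pi> \<in> SX X" for \<pi>
      using conj_map_auto[OF that] by (simp add: auto_def)
    then show "conj_map X \<in> hom (SX_group X) (AutoGroup (PI_monoid X))"
      by (intro homI) (simp_all add: SX_group_def AutoGroup_def BijGroup_def mult conj_map_auto)
    show "bij_betw (conj_map X) (carrier (SX_group X)) (carrier (AutoGroup (PI_monoid X)))"
      using inj_conj_map surj by (simp add: bij_betw_def SX_group_def AutoGroup_def)
  qed
  then show "AutoGroup (PI_monoid X) \<cong> SX_group X"
    by (intro group.iso_sym[OF group_SX_group] is_isoI)
qed

end
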